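(* Let $s\in(1/2,1]$ and let $x\in(0,1)$ be irrational, with continued fraction convergents $(p_j/q_j)_{j\ge 1}$. For every $j\ge 1$ set $\delta_j=1$ if $s\in(1/2,1)$ and $\delta_j=\log(q_{j+1}/q_j)$ if $s=1$, and let $$\Sigma_s(x)=\sum_{j:\ q_j\neq 2*\mathrm{odd}}\delta_j\sqrt{\frac{q_{j+1}}{(q_jq_{j+1})^{s}}}\in[0,+\infty].$$ Consider the series $F_s(x)=\sum_{n=1}^{+\infty}\frac{e^{2i\pi n^2x}}{n^s}$ (convergence meaning convergence of its partial sums). (i) $F_s(x)$ converges whenever $\frac{s-1+1/r_{\mathrm{odd}}(x)}{2}>0$. In fact, it converges whenever $\Sigma_s(x)<+\infty$. (ii) $F_s(x)$ does not converge if $\frac{s-1+1/r_{\mathrm{odd}}(x)}{2}<0$. In fact, it does not converge whenever $$\limsup_{j\to\infty,\ q_j\neq 2*\mathrm{odd}}\ \delta_j\sqrt{\frac{q_{j+1}}{(q_jq_{j+1})^{s}}}>0.$$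
   Context: Convergents $p_j/q_j$ are in lowest terms with $q_j>0$. The condition "$q\neq 2*\mathrm{odd}$" means that $q$ is not twice an odd integer, i.e. $q\not\equiv 2 \pmod 4$. For an irrational $x$ with convergents $(p_j/q_j)_{j\ge1}$, write $x-\frac{p_j}{q_j}=h_j$ and $|h_j|=q_j^{-r_j}$, with $2\le r_j<\infty$ (this defines $r_j$ as soon as $q_j\ge 2$, i.e. for all but finitely many $j$). The approximation rate is $$r_{\mathrm{odd}}(x)=\limsup_{j\to\infty}\{r_j:\ q_j\neq 2*\mathrm{odd}\}\in[2,+\infty].$$ There are always infinitely many $j$ with $q_j\neq 2*\mathrm{odd}$. By convention $1/(+\infty)=0$. *)

theory Defs
  imports "HOL-Analysis.Analysis"
begin

text \<open>Complete quotients and partial quotients of the regular continued fraction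
  \<open>x = [a\<^sub>0; a\<^sub>1, a\<^sub>2, \<dots>]\<close>; they are only meaningful for all indices when \<open>x\<close> is irrational.\<close>

primrec cfrac_quot :: "real \<Rightarrow> nat \<Rightarrow> real" where
  "cfrac_quot x 0 = x"
| "cfrac_quot x (Suc n) = 1 / frac (cfrac_quot x n)"

definition cfrac_coeff :: "real \<Rightarrow> nat \<Rightarrow> int" where
  "cfrac_coeff x n = \<lfloor>cfrac_quot x n\<rfloor>"

text \<open>Indexed so that the convergent number \<open>j\<close> is \<open>[a\<^sub>0; a\<^sub>1, \<dots>, a\<^sub>j]\<close>. For \<open>x \<in> (0,1)\<close>
  the convergents number 0 and 1 are \<open>0/1\<close> and \<open>1/a\<^sub>1\<close>.\<close>

fun conv_num :: "real \<Rightarrow> nat \<Rightarrow> int" where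
  "conv_num x 0 = cfrac_coeff x 0"
| "conv_num x (Suc 0) = cfrac_coeff x 1 * cfrac_coeff x 0 + 1"
| "conv_num x (Suc (Suc n)) = cfrac_coeff x (Suc (Suc n)) * conv_num x (Suc n) + conv_num x n"

fun conv_denom :: "real \<Rightarrow> nat \<Rightarrow> int" where
  "conv_denom x 0 = 1"
| "conv_denom x (Suc 0) = cfrac_coeff x 1"
| "conv_denom x (Suc (Suc n)) = cfrac_coeff x (Suc (Suc n)) * conv_denom x (Suc n) + conv_denom x n"

lemma cfrac_quot_irrational: "x \<notin> \<rat> \<Longrightarrow> cfrac_quot x n \<notin> \<rat>"
proof (induction n)
  case (Suc n)
  show ?case
  proof
    assume "cfrac_quot x (Suc n) \<in> \<rat>"
    then have "1 / cfrac_quot x (Suc n) \<in> \<rat>"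
      by (rule Rats_divide[OF Rats_1])
    then have "frac (cfrac_quot x n) + of_int \<lfloor>cfrac_quot x n\<rfloor> \<in> \<rat>"
      by (intro Rats_add Rats_of_int) (simp del: Rats_divide)
    then show False
      using Suc by (simp add: frac_def)
  qed
qed simp

lemma cfrac_coeff_pos:
  assumes "x \<notin> \<rat>"
  shows "cfrac_coeff x (Suc n) \<ge> 1"
proof -
  have "cfrac_quot x n \<notin> \<int>"
    using cfrac_quot_irrational[OF assms] Ints_subset_Rats by blast
  then have "frac (cfrac_quot x n) > 0"
    by simp
  moreover have "frac (cfrac_quot x n) < 1"
    by (rule frac_lt_1)
  ultimately show ?thesis
    by (simp add: cfrac_coeff_def le_floor_iff)
qed

lemma conv_denom_pos: "x \<notin> \<rat> \<Longrightarrow> conv_denom x n > 0"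
proof (induction x n rule: conv_denom.induct)
  case (2 x)
  then show ?case using cfrac_coeff_pos[of x 0] by simp
next
  case (3 x n)
  have "cfrac_coeff x (Suc (Suc n)) * conv_denom x (Suc n) > 0"
    using 3 cfrac_coeff_pos[of x "Suc n"] by (intro mult_pos_pos) auto
  then show ?case using 3 by simp
qed simp

lemma conv_det:
  "conv_num x (Suc n) * conv_denom x n - conv_num x n * conv_denom x (Suc n) = (- 1) ^ n"
  by (induction n) (simp_all add: algebra_simps)

lemma coprime_conv: "coprime (conv_num x n) (conv_denom x n)"
proof (rule coprimeI)
  fix d assume "d dvd conv_num x n" "d dvd conv_denom x n"
  then have "d dvd (- 1) ^ n"
    unfolding conv_det[of x n, symmetric] by (intro dvd_diff dvd_mult dvd_mult2)
  then show "is_unit d"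
    by (metis dvd_trans dvd_unit_imp_unit is_unit_power_iff minus_dvd_iff one_dvd dvd_refl)
qed

definition twice_odd :: "int \<Rightarrow> bool" where
  "twice_odd q \<longleftrightarrow> (\<exists>m. odd m \<and> q = 2 * m)"

definition adm_indices :: "real \<Rightarrow> nat set" where
  "adm_indices x = {j. 1 \<le> j \<and> \<not> twice_odd (conv_denom x j)}"

text \<open>The exponent \<open>r\<^sub>j\<close> with \<open>\<bar>x - p\<^sub>j/q\<^sub>j\<bar> = q\<^sub>j powr (- r\<^sub>j)\<close>; a dummy value if \<open>q\<^sub>j = 1\<close>.\<close>

definition approx_exponent :: "real \<Rightarrow> nat \<Rightarrow> real" where
  "approx_exponent x j =
     - log (conv_denom x j) \<bar>x - conv_num x j / conv_denom x j\<bar>"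

lemma approx_exponent_powr:
  assumes "x \<notin> \<rat>" "conv_denom x j \<ge> 2"
  shows "\<bar>x - conv_num x j / conv_denom x j\<bar> = conv_denom x j powr (- approx_exponent x j)"
proof -
  have "x \<noteq> conv_num x j / conv_denom x j"
    using assms(1) by (metis Rats_divide Rats_of_int)
  then show ?thesis
    using assms(2) by (simp add: approx_exponent_def)
qed

text \<open>A limit superior along the admissible indices only. The filter is proper because
  infinitely many indices are admissible, and finitely many dummy values do not matter.\<close>

definition r_odd :: "real \<Rightarrow> ereal" where
  "r_odd x = Limsup (inf sequentially (principal (adm_indices x)))
     (\<lambda>j. ereal (approx_exponent x j))"

definition delta_wt :: "real \<Rightarrow> real \<Rightarrow> nat \<Rightarrow> real" where
  "delta_wt s x j = (if s = 1 then ln (conv_denom x (Suc j) / conv_denom x j) else 1)"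

definition conv_weight :: "real \<Rightarrow> real \<Rightarrow> nat \<Rightarrow> real" where
  "conv_weight s x j = delta_wt s x j *
     sqrt (conv_denom x (Suc j) / (conv_denom x j * conv_denom x (Suc j)) powr s)"

definition Sigma_sum :: "real \<Rightarrow> real \<Rightarrow> ennreal" where
  "Sigma_sum s x = (\<Sum>j. if j \<in> adm_indices x then ennreal (conv_weight s x j) else 0)"

definition F_partial :: "real \<Rightarrow> real \<Rightarrow> nat \<Rightarrow> complex" where
  "F_partial s x N =
     (\<Sum>n = 1..N. exp (2 * \<i> * of_real pi * of_nat n ^ 2 * of_real x) / of_real (real n powr s))"

end

theory Submission
  imports Defs
begin

text \<open>Near a convergent write \<open>x = p/q + h\<close>. As long as \<open>4 q \<bar>h\<bar> N \<le> 1\<close>, which covers all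
  \<open>N \<le> q\<^sub>j\<^sub>+\<^sub>1 / 4\<close>, the sum of \<open>e(n\<^sup>2 x)\<close> over \<open>n \<le> N\<close> equals the normalised Gauss sum
  \<open>G(p, q) / q\<close> times the sum of \<open>e(h n\<^sup>2)\<close>, up to an error \<open>O(sqrt q log q)\<close>. Since \<open>s > 1/2\<close>,
  these errors weighted by \<open>n powr -s\<close> over the blocks \<open>q\<^sub>j / 4 \<le> n \<le> q\<^sub>j\<^sub>+\<^sub>1 / 4\<close> are summable in
  \<open>j\<close>. The Gauss sum vanishes if \<open>q\<close> is twice an odd number and has modulus comparable to
  \<open>sqrt q\<close> otherwise. The weighted sum of \<open>e(h n\<^sup>2)\<close> has no cancellation up to
  \<open>n = sqrt (q\<^sub>j q\<^sub>j\<^sub>+\<^sub>1)\<close>, which is about \<open>\<bar>h\<bar> powr -1/2\<close>, and contributes no larger order beyond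
  that point. So the block of an admissible \<open>j\<close> is of exact order \<open>conv_weight s x j\<close>.\<close>

section \<open>Exponential sums with monotone increments\<close>

text \<open>The condition \<open>4 q \<bar>h\<bar> N \<le> 1\<close> comes from expanding over
  frequencies b/q modulo q. For 0 < b < q the number b/q is at distance at least 1/q from the
  integers, and the increments of h n^2 may consume at most half of that distance, so every nonzero
  frequency still oscillates. The two directions need different control. Convergence needs an upper
  bound for every partial block. Divergence needs one stretch violating the Cauchy criterion: from
  q_j up to a quarter of K = sqrt (q_j q_{j+1}) the phase h n^2 stays within 1/16, so each term has
  real part at least half its modulus. The exponent r_j enters only through q_j^{r_j} = 1/|h|, which
  equals q_j q_{j+1} up to a factor 2. For s < 1 the weight is therefore q_j^{(r_j (1-s) - 1)/2} up
  to constants, and this exponent is negative or positive according as s - 1 + 1/r_j is positive or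
  negative. Together with the geometric growth of q_j this turns the condition on the approximation
  rate into a condition on the weights.\<close>

definition unit_exp :: "real \<Rightarrow> complex" where
  "unit_exp t = cis (2 * pi * t)"

lemma norm_unit_exp [simp]: "norm (unit_exp t) = 1"
  by (simp add: unit_exp_def)

lemma unit_exp_add: "unit_exp (s + t) = unit_exp s * unit_exp t"
  by (simp add: unit_exp_def cis_mult algebra_simps)

lemma unit_exp_0 [simp]: "unit_exp 0 = 1"
  by (simp add: unit_exp_def)

lemma unit_exp_Ints: "t \<in> \<int> \<Longrightarrow> unit_exp t = 1"
  by (simp add: unit_exp_def)

lemma unit_exp_of_int [simp]: "unit_exp (of_int k) = 1"
  by (simp add: unit_exp_Ints)

lemma cnj_unit_exp: "cnj (unit_exp t) = unit_exp (- t)"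
  by (simp add: unit_exp_def cis_cnj)

lemma unit_exp_diff: "unit_exp (s - t) = unit_exp s * cnj (unit_exp t)"
  by (simp add: cnj_unit_exp flip: unit_exp_add)

lemma unit_exp_cong: "s - t \<in> \<int> \<Longrightarrow> unit_exp s = unit_exp t"
  using unit_exp_add[of t "s - t"] by (simp add: unit_exp_Ints)

lemma unit_exp_eq_1_iff: "unit_exp t = 1 \<longleftrightarrow> t \<in> \<int>"
proof
  assume "unit_exp t = 1"
  then have "cos (2 * pi * t) = 1"
    by (simp add: unit_exp_def complex_eq_iff)
  then obtain n :: int where "2 * pi * t = of_int n * 2 * pi"
    using cos_one_2pi_int by auto
  then show "t \<in> \<int>" by simp
qed (rule unit_exp_Ints)

text \<open>Summation by parts. The decrements of the weights are nonnegative, so they telescope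
  under the norm and only the first weight remains. A bound on all initial partial sums is required,
  not just on the full sum.\<close>

lemma sum_mult_abel_bound:
  fixes w :: "nat \<Rightarrow> real" and z :: "nat \<Rightarrow> 'a :: real_normed_vector"
  assumes "M < N" "0 \<le> B"
    and "\<And>k. M < k \<Longrightarrow> k \<le> N \<Longrightarrow> 0 \<le> w k"
    and "\<And>k. M < k \<Longrightarrow> k < N \<Longrightarrow> w (Suc k) \<le> w k"
    and "\<And>k. M < k \<Longrightarrow> k \<le> N \<Longrightarrow> norm (\<Sum>n\<in>{M<..k}. z n) \<le> B"
  shows "norm (\<Sum>n\<in>{M<..N}. w n *\<^sub>R z n) \<le> w (Suc M) * B"
proof -
  define A where "A k = (\<Sum>n\<in>{M<..k}. z n)" for k
  have set_Suc: "{M<..Suc k} = insert (Suc k) {M<..k}" if "M \<le> k" for k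
    using that by auto
  have "Suc M + d \<le> N \<Longrightarrow> norm ((\<Sum>n\<in>{M<..Suc M + d}. w n *\<^sub>R z n) - w (Suc M + d) *\<^sub>R A (Suc M + d))
      \<le> (w (Suc M) - w (Suc M + d)) * B" for d
  proof (induction d)
    case 0
    show ?case by (simp add: A_def set_Suc)
  next
    case (Suc d)
    let ?k = "Suc M + d"
    have "(\<Sum>n\<in>{M<..Suc ?k}. w n *\<^sub>R z n) - w (Suc ?k) *\<^sub>R A (Suc ?k)
        = ((\<Sum>n\<in>{M<..?k}. w n *\<^sub>R z n) - w ?k *\<^sub>R A ?k) + (w ?k - w (Suc ?k)) *\<^sub>R A ?k"
      by (simp add: A_def set_Suc algebra_simps)
    also have "norm \<dots> \<le> (w (Suc M) - w ?k) * B + (w ?k - w (Suc ?k)) * B"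
    proof (rule norm_triangle_le, rule add_mono)
      show "norm ((w ?k - w (Suc ?k)) *\<^sub>R A ?k) \<le> (w ?k - w (Suc ?k)) * B"
        using assms(4)[of ?k] assms(5)[of ?k] Suc.prems by (simp add: A_def mult_left_mono)
    qed (use Suc in simp)
    finally show ?case by (simp add: algebra_simps)
  qed
  from this[of "N - Suc M"] have *: "norm ((\<Sum>n\<in>{M<..N}. w n *\<^sub>R z n) - w N *\<^sub>R A N)
      \<le> (w (Suc M) - w N) * B"
    using assms(1) by simp
  have "norm (w N *\<^sub>R A N) \<le> w N * B"
    using assms(1,3,5) by (simp add: A_def mult_left_mono)
  then have "norm (\<Sum>n\<in>{M<..N}. w n *\<^sub>R z n) \<le> (w (Suc M) - w N) * B + w N * B"
    using * norm_triangle_sub[of "\<Sum>n\<in>{M<..N}. w n *\<^sub>R z n" "w N *\<^sub>R A N"] by linarith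
  then show ?thesis by (simp add: algebra_simps)
qed

lemma cot_decreasing:
  fixes a b :: real
  assumes "0 < a" "a \<le> b" "b < pi"
  shows "cot b \<le> cot a"
proof -
  have "sin a > 0" "sin b > 0"
    using assms by (auto intro: sin_gt_zero)
  moreover have "sin (b - a) \<ge> 0"
    using assms by (intro sin_ge_zero) auto
  ultimately show ?thesis
    by (simp add: cot_def divide_simps sin_diff mult.commute)
qed

lemma cot_le_inverse:
  fixes t :: real
  assumes "0 < t" "t < pi"
  shows "cot t \<le> 1 / t"
proof -
  define f where "f u = sin u - u * cos u" for u :: real
  have "f 0 \<le> f t"
  proof (rule DERIV_nonneg_imp_nondecreasing[of 0 t f])
    fix u assume u: "0 \<le> u" "u \<le> t"
    show "\<exists>y. (f has_real_derivative y) (at u) \<and> 0 \<le> y"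
      using u assms sin_ge_zero[of u] unfolding f_def
      by (intro exI[of _ "u * sin u"]) (auto intro!: derivative_eq_intros)
  qed (use assms in auto)
  then show ?thesis
    using assms sin_gt_zero[of t] by (simp add: f_def cot_def field_simps)
qed

text \<open>The real part is constant, so differences of such coefficients are purely imaginary and
  have the sign of a difference of cotangents. This is what lets a monotone phase increment
  telescope.\<close>

lemma inverse_one_minus_unit_exp:
  assumes "0 < t" "t < 1"
  shows "1 / (1 - unit_exp t) = Complex (1/2) (cot (pi * t) / 2)"
proof -
  define u v where "u = sin (pi * t)" and "v = cos (pi * t)"
  have u: "u > 0"
    unfolding u_def using assms by (intro sin_gt_zero) auto
  have uv: "u * u + v * v = 1"
    using sin_cos_squared_add[of "pi * t"] by (simp add: u_def v_def power2_eq_square)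
  have "1 - unit_exp t = Complex (2 * u * u) (- (2 * u * v))"
    using cos_double_sin[of "pi * t"] sin_double[of "pi * t"]
    by (simp add: u_def v_def unit_exp_def complex_eq_iff power2_eq_square mult.assoc)
  moreover have "cot (pi * t) = v / u"
    by (simp add: u_def v_def cot_def)
  ultimately have "(1 - unit_exp t) * Complex (1/2) (cot (pi * t) / 2) = 1"
    using u uv by (simp add: complex_eq_iff)
  then show ?thesis
    by (metis mult_zero_left nonzero_mult_div_cancel_left zero_neq_one mult.commute)
qed

text \<open>The Kusmin--Landau inequality. Writing \<open>e(f n)\<close> as the difference of \<open>e(f n)\<close> and
  \<open>e(f (n + 1))\<close> divided by \<open>1 - e(g n)\<close>, where \<open>g\<close> is the increment of \<open>f\<close>, the sum telescopes
  up to the variation of \<open>cot (\<pi> g n)\<close>, which is monotone.\<close>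

lemma kusmin_landau_mono:
  fixes f :: "nat \<Rightarrow> real"
  assumes "0 < \<theta>"
    and range: "\<And>n. M < n \<Longrightarrow> n < N \<Longrightarrow> \<theta> \<le> f (Suc n) - f n \<and> f (Suc n) - f n \<le> 1 - \<theta>"
    and mono: "\<And>n. M < n \<Longrightarrow> Suc n < N \<Longrightarrow> f (Suc n) - f n \<le> f (Suc (Suc n)) - f (Suc n)"
    and "\<theta> \<le> 1"
  shows "norm (\<Sum>n\<in>{M<..N}. unit_exp (f n)) \<le> 2 / \<theta>"
proof (cases "Suc M < N")
  case False
  then have "{M<..N} = {} \<or> {M<..N} = {Suc M}" by auto
  then show ?thesis using assms by (auto simp: divide_simps)
next
  case True
  define g where "g n = f (Suc n) - f n" for n
  define k where "k n = cot (pi * g n)" for n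
  define c where "c n = 1 / (1 - unit_exp (g n))" for n
  have g: "0 < g n" "g n < 1" "\<theta> \<le> g n" "g n \<le> 1 - \<theta>" if "M < n" "n < N" for n
    using range[OF that] assms(1) by (auto simp: g_def)
  have \<theta>: "\<theta> \<le> 1/2"
    using g(3,4)[of "Suc M"] True by simp
  have c: "c n = Complex (1/2) (k n / 2)" if "M < n" "n < N" for n
    using inverse_one_minus_unit_exp g that by (simp add: c_def k_def)
  have e: "unit_exp (f n) = c n * (unit_exp (f n) - unit_exp (f (Suc n)))" if "M < n" "n < N" for n
  proof -
    have "unit_exp (g n) \<noteq> 1"
      using g(1,2)[OF that] by (auto simp: unit_exp_eq_1_iff elim!: Ints_cases)
    moreover have "unit_exp (f (Suc n)) = unit_exp (f n) * unit_exp (g n)"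
      by (simp add: g_def flip: unit_exp_add)
    ultimately show ?thesis by (simp add: c_def field_simps)
  qed
  have k_mono: "k (Suc n) \<le> k n" if "M < n" "Suc n < N" for n
    unfolding k_def using that g[of n] g[of "Suc n"] mono[OF that]
    by (intro cot_decreasing) (auto simp: g_def)
  have kub: "k n \<le> 1 / (2 * \<theta>)" if "M < n" "n < N" for n
  proof -
    have "k n \<le> 1 / (pi * g n)"
      unfolding k_def using g[OF that] by (intro cot_le_inverse) auto
    also have "\<dots> \<le> 1 / (2 * \<theta>)"
      using g[OF that] assms(1) pi_ge_two by (intro divide_left_mono mult_mono mult_pos_pos) auto
    finally show ?thesis .
  qed
  have klb: "- k n \<le> 1 / (2 * \<theta>)" if "M < n" "n < N" for n
  proof -
    have "- k n = cot (pi * (1 - g n))"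
      using sin_diff[of pi "pi * g n"] cos_diff[of pi "pi * g n"]
      by (simp add: k_def cot_def algebra_simps)
    also have "\<dots> \<le> 1 / (pi * (1 - g n))"
      using g[OF that] by (intro cot_le_inverse) auto
    also have "\<dots> \<le> 1 / (2 * \<theta>)"
      using g[OF that] assms(1) pi_ge_two by (intro divide_left_mono mult_mono mult_pos_pos) auto
    finally show ?thesis .
  qed
  have cb: "norm (c n) \<le> 1 / (2 * \<theta>)" if "M < n" "n < N" for n
  proof -
    have "norm (c n) \<le> \<bar>1/2\<bar> + \<bar>k n / 2\<bar>"
      using cmod_le[of "c n"] c[OF that] by simp
    also have "\<dots> \<le> 1 / (4 * \<theta>) + 1 / (4 * \<theta>)"
      using kub[OF that] klb[OF that] \<theta> assms(1) by (intro add_mono) (auto simp: field_simps abs_le_iff)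
    finally show ?thesis by (simp add: field_simps)
  qed
  \<comment> \<open>Invariant of the summation by parts: with both boundary terms removed, what
    remains is the sum of \<open>(c (n + 1) - c n) * unit_exp (f (n + 1))\<close>, whose norm
    telescopes to half the total drop of \<open>k\<close>.\<close>
  have "Suc M + d < N \<Longrightarrow> norm ((\<Sum>n\<in>{M<..Suc M + d}. unit_exp (f n)) - c (Suc M) * unit_exp (f (Suc M))
      + c (Suc M + d) * unit_exp (f (Suc (Suc M + d)))) \<le> (k (Suc M) - k (Suc M + d)) / 2" for d
  proof (induction d)
    case 0
    have "{M<..Suc M} = {Suc M}" by auto
    then show ?case using e[of "Suc M"] 0 by (simp add: algebra_simps)
  next
    case (Suc d)
    let ?k = "Suc M + d"
    have "{M<..Suc ?k} = insert (Suc ?k) {M<..?k}" by auto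
    then have "(\<Sum>n\<in>{M<..Suc ?k}. unit_exp (f n)) - c (Suc M) * unit_exp (f (Suc M))
      + c (Suc ?k) * unit_exp (f (Suc (Suc ?k))) = ((\<Sum>n\<in>{M<..?k}. unit_exp (f n)) - c (Suc M) * unit_exp (f (Suc M))
      + c ?k * unit_exp (f (Suc ?k))) + (unit_exp (f (Suc ?k)) - c ?k * unit_exp (f (Suc ?k)) + c (Suc ?k) * unit_exp (f (Suc (Suc ?k))))"
      by simp
    also have "unit_exp (f (Suc ?k)) - c ?k * unit_exp (f (Suc ?k)) + c (Suc ?k) * unit_exp (f (Suc (Suc ?k)))
       = (c (Suc ?k) - c ?k) * unit_exp (f (Suc ?k))"
    proof -
      have "unit_exp (f (Suc ?k)) = c (Suc ?k) * unit_exp (f (Suc ?k)) - c (Suc ?k) * unit_exp (f (Suc (Suc ?k)))"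
        using e[of "Suc ?k"] Suc.prems by (simp add: right_diff_distrib)
      then show ?thesis by (simp add: algebra_simps)
    qed
    also have "norm ((\<Sum>n\<in>{M<..?k}. unit_exp (f n)) - c (Suc M) * unit_exp (f (Suc M))
      + c ?k * unit_exp (f (Suc ?k)) + (c (Suc ?k) - c ?k) * unit_exp (f (Suc ?k)))
      \<le> (k (Suc M) - k ?k) / 2 + (k ?k - k (Suc ?k)) / 2"
    proof (rule norm_triangle_le, rule add_mono)
      have "c (Suc ?k) - c ?k = Complex 0 ((k (Suc ?k) - k ?k) / 2)"
        using c[of ?k] c[of "Suc ?k"] Suc.prems by (simp add: complex_eq_iff field_simps)
      then have "norm (c (Suc ?k) - c ?k) = \<bar>k (Suc ?k) - k ?k\<bar> / 2"
        by (simp add: cmod_def)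
      then show "norm ((c (Suc ?k) - c ?k) * unit_exp (f (Suc ?k))) \<le> (k ?k - k (Suc ?k)) / 2"
        using k_mono[of ?k] Suc.prems by (simp add: norm_mult)
    qed (use Suc in simp)
    finally show ?case by (simp add: field_simps)
  qed
  moreover obtain d where "N = Suc (Suc M + d)"
    using True less_iff_Suc_add by fastforce
  ultimately have *: "norm ((\<Sum>n\<in>{M<..N-1}. unit_exp (f n)) - c (Suc M) * unit_exp (f (Suc M))
      + c (N-1) * unit_exp (f N)) \<le> (k (Suc M) - k (N-1)) / 2"
    by auto
  define u v w where "u = (\<Sum>n\<in>{M<..N-1}. unit_exp (f n))" and "v = c (Suc M) * unit_exp (f (Suc M))"
    and "w = c (N-1) * unit_exp (f N)"
  have "{M<..N} = insert N {M<..N-1}" using True by auto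
  moreover have "N \<notin> {M<..N-1}" using True by auto
  ultimately have "(\<Sum>n\<in>{M<..N}. unit_exp (f n)) = (u - v + w) + (v + (unit_exp (f N) - w))"
    by (simp add: u_def)
  \<comment> \<open>Four contributions, each at most 1/(2 \<theta>): the telescoped part, the two
    boundary terms, and the last summand of modulus 1, for which \<theta> <= 1/2 is used.\<close>
  then have "norm (\<Sum>n\<in>{M<..N}. unit_exp (f n)) \<le> norm (u - v + w) + (norm v + (1 + norm w))"
    by (metis norm_triangle_le add_left_mono norm_triangle_ineq norm_triangle_ineq4 norm_unit_exp order_trans)
  moreover have "norm v \<le> 1 / (2 * \<theta>)" "norm w \<le> 1 / (2 * \<theta>)"
    using cb[of "Suc M"] cb[of "N - 1"] True by (auto simp: v_def w_def norm_mult)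
  moreover have "norm (u - v + w) \<le> 1 / (2 * \<theta>)"
  proof -
    have "k (Suc M) \<le> 1 / (2 * \<theta>)" "- k (N - 1) \<le> 1 / (2 * \<theta>)"
      using kub[of "Suc M"] klb[of "N-1"] True by auto
    then show ?thesis
      using * unfolding u_def v_def w_def by argo
  qed
  moreover have "1 \<le> 1 / (2 * \<theta>)" using \<theta> assms(1) by simp
  ultimately show ?thesis by (simp add: field_simps)
qed

text \<open>Conjugating, and adding the integer n to the phase, turns an increment g into 1 - g. The
  interval from \<theta> to 1 - \<theta> is symmetric under this map and monotonicity is
  reversed.\<close>

lemma kusmin_landau_antimono:
  fixes f :: "nat \<Rightarrow> real"
  assumes "0 < \<theta>"
    and range: "\<And>n. M < n \<Longrightarrow> n < N \<Longrightarrow> \<theta> \<le> f (Suc n) - f n \<and> f (Suc n) - f n \<le> 1 - \<theta>"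
    and mono: "\<And>n. M < n \<Longrightarrow> Suc n < N \<Longrightarrow> f (Suc (Suc n)) - f (Suc n) \<le> f (Suc n) - f n"
    and "\<theta> \<le> 1"
  shows "norm (\<Sum>n\<in>{M<..N}. unit_exp (f n)) \<le> 2 / \<theta>"
proof -
  have "unit_exp (f n) = cnj (unit_exp (real n - f n))" for n
    using unit_exp_of_int[of "int n"] by (simp add: cnj_unit_exp unit_exp_diff)
  then have "(\<Sum>n\<in>{M<..N}. unit_exp (f n)) = cnj (\<Sum>n\<in>{M<..N}. unit_exp (real n - f n))"
    by simp
  moreover have "norm (\<Sum>n\<in>{M<..N}. unit_exp (real n - f n)) \<le> 2 / \<theta>"
    by (rule kusmin_landau_mono) (use assms in \<open>auto simp: algebra_simps\<close>)
  ultimately show ?thesis by (metis complex_mod_cnj)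
qed

text \<open>The increment of the phase at n is h (2n + 1) + c, monotone in the direction of the sign
  of h. The linear coefficient c later carries either a frequency b/q or an integer shift.\<close>

lemma kusmin_landau_quadratic:
  fixes h c \<theta> :: real
  assumes "0 < \<theta>" "\<theta> \<le> 1"
    and "\<And>n. M < n \<Longrightarrow> n < N \<Longrightarrow> \<theta> \<le> h * (2 * real n + 1) + c \<and> h * (2 * real n + 1) + c \<le> 1 - \<theta>"
  shows "norm (\<Sum>n\<in>{M<..N}. unit_exp (h * real n ^ 2 + c * real n)) \<le> 2 / \<theta>"
proof (cases "h \<ge> 0")
  case True
  show ?thesis
    by (rule kusmin_landau_mono)
       (use assms True in \<open>auto simp: algebra_simps power2_eq_square\<close>)
next
  case False
  show ?thesis
    by (rule kusmin_landau_antimono)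
       (use assms False in \<open>auto simp: algebra_simps power2_eq_square\<close>)
qed

section \<open>Gauss sums\<close>

lemma unit_exp_frac_cong:
  fixes a b q :: int
  assumes "a mod q = b mod q"
  shows "unit_exp (of_int a / of_int q) = unit_exp (of_int b / of_int q)"
proof (cases "q = 0")
  case False
  obtain k where "a - b = q * k"
    using assms by (metis mod_eq_dvd_iff dvdE)
  then have "real_of_int a = of_int b + of_int q * of_int k"
    by (metis add.commute diff_add_cancel of_int_add of_int_mult)
  then have "of_int a / real_of_int q - of_int b / of_int q = of_int k"
    using False by (simp add: field_simps)
  then show ?thesis
    by (intro unit_exp_cong) simp
qed simp

lemma sum_residues_shift:
  fixes f :: "int \<Rightarrow> 'a :: comm_monoid_add"
  assumes "q > 0" "\<And>m. f (m mod q) = f m"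
  shows "(\<Sum>m\<in>{0..<q}. f (m + d)) = (\<Sum>m\<in>{0..<q}. f m)"
  by (rule sum.reindex_bij_witness[where i = "\<lambda>m. (m - d) mod q" and j = "\<lambda>m. (m + d) mod q"])
     (use assms in \<open>auto simp: mod_simps\<close>)

text \<open>Orthogonality of additive characters: shifting the summation variable by 1 multiplies
  the sum by e(k/q), which differs from 1 unless q divides k.\<close>

lemma sum_unit_exp_residues:
  fixes k q :: int
  assumes "q > 0"
  shows "(\<Sum>m\<in>{0..<q}. unit_exp (of_int (k * m) / of_int q)) = (if q dvd k then of_int q else 0)"
proof (cases "q dvd k")
  case True
  then have "unit_exp (of_int (k * m) / of_int q) = 1" for m
    using unit_exp_frac_cong[of "k * m" q 0] by simp
  then show ?thesis using True assms by simp
next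
  case False
  let ?S = "\<Sum>m\<in>{0..<q}. unit_exp (of_int (k * m) / of_int q)"
  have "?S = (\<Sum>m\<in>{0..<q}. unit_exp (of_int (k * (m + 1)) / of_int q))"
    by (intro sum_residues_shift[symmetric] unit_exp_frac_cong) (use assms in \<open>simp_all add: mod_simps\<close>)
  also have "\<dots> = ?S * unit_exp (of_int k / of_int q)"
    by (simp add: sum_distrib_right distrib_left add_divide_distrib flip: unit_exp_add)
  finally have "?S * (1 - unit_exp (of_int k / of_int q)) = 0"
    by (simp add: algebra_simps)
  moreover have "unit_exp (of_int k / of_int q) \<noteq> 1"
  proof
    assume "unit_exp (of_int k / of_int q) = 1"
    then obtain m :: int where "of_int k / of_int q = real_of_int m"
      unfolding unit_exp_eq_1_iff by (auto elim: Ints_cases)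
    then have "real_of_int k = of_int (m * q)"
      using assms by (simp add: field_simps)
    then have "k = m * q" by linarith
    then show False using False by simp
  qed
  ultimately show ?thesis using False by simp
qed

text \<open>The finite Fourier coefficient at frequency b of the q-periodic function e(p m^2 / q);
  the minus sign makes the inversion formula carry +b.\<close>

definition gauss_sum :: "int \<Rightarrow> int \<Rightarrow> int \<Rightarrow> complex" where
  "gauss_sum p q b = (\<Sum>m\<in>{0..<q}. unit_exp (of_int (p * m\<^sup>2 - b * m) / of_int q))"

lemma quadratic_mod: "(p * (m mod q)\<^sup>2 - b * (m mod q)) mod q = (p * m\<^sup>2 - b * m) mod q"
  for p q m b :: int
  by (intro mod_diff_cong mod_mult_cong refl) (simp_all add: power_mod)

text \<open>Fourier inversion modulo q: inserting the definition and summing over b first leaves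
  only the residue m of n.\<close>

lemma quadratic_phase_eq_gauss_sum:
  fixes n p q :: int
  assumes "q > 0"
  shows "unit_exp (of_int (p * n\<^sup>2) / of_int q)
    = (\<Sum>b\<in>{0..<q}. gauss_sum p q b * unit_exp (of_int (b * n) / of_int q)) / of_int q"
proof -
  let ?r = "n mod q"
  have "(\<Sum>b\<in>{0..<q}. gauss_sum p q b * unit_exp (of_int (b * n) / of_int q))
      = (\<Sum>b\<in>{0..<q}. \<Sum>m\<in>{0..<q}. unit_exp (of_int (p * m\<^sup>2) / of_int q) * unit_exp (of_int ((n - m) * b) / of_int q))"
    unfolding gauss_sum_def sum_distrib_right
    by (intro sum.cong refl) (simp add: algebra_simps diff_divide_distrib add_divide_distrib flip: unit_exp_add)
  also have "\<dots> = (\<Sum>m\<in>{0..<q}. unit_exp (of_int (p * m\<^sup>2) / of_int q) * (if q dvd n - m then of_int q else 0))"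
    by (subst sum.swap) (simp only: sum_unit_exp_residues[OF assms] flip: sum_distrib_left)
  also have "\<dots> = (\<Sum>m\<in>{0..<q}. if m = ?r then unit_exp (of_int (p * m\<^sup>2) / of_int q) * of_int q else 0)"
  proof (intro sum.cong refl)
    fix m assume "m \<in> {0..<q}"
    then have "q dvd n - m \<longleftrightarrow> m = ?r"
      by (auto simp flip: mod_eq_dvd_iff)
    then show "unit_exp (of_int (p * m\<^sup>2) / of_int q) * (if q dvd n - m then of_int q else 0)
      = (if m = ?r then unit_exp (of_int (p * m\<^sup>2) / of_int q) * of_int q else 0)"
      by simp
  qed
  also have "\<dots> = unit_exp (of_int (p * ?r\<^sup>2) / of_int q) * of_int q"
    using assms by simp
  also have "unit_exp (of_int (p * ?r\<^sup>2) / of_int q) = unit_exp (of_int (p * n\<^sup>2) / of_int q)"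
    using quadratic_mod[of p n q 0] by (intro unit_exp_frac_cong) simp
  finally show ?thesis using assms by simp
qed

text \<open>After squaring out, the substitution n = m + d makes the phase linear in m, and
  orthogonality keeps only those d with q dividing 2d: d = 0, and d = q/2 for even q. The second one
  has phase p q/4 - b/2, which at b = 0 distinguishes multiples of 4 from twice odd numbers.\<close>

lemma norm_gauss_sum_squared:
  fixes p q b :: int
  assumes "q > 0" "coprime p q"
  shows "complex_of_real ((norm (gauss_sum p q b))\<^sup>2)
    = (if even q then of_int q * (1 + unit_exp (of_int (p * q) / 4 - of_int b / 2)) else of_int q)"
proof -
  let ?\<phi> = "\<lambda>m. p * m\<^sup>2 - b * m"
  let ?e = "\<lambda>k. unit_exp (of_int k / of_int q)"
  have "complex_of_real ((norm (gauss_sum p q b))\<^sup>2) = gauss_sum p q b * cnj (gauss_sum p q b)"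
    using complex_norm_square by simp
  also have "\<dots> = (\<Sum>m\<in>{0..<q}. \<Sum>n\<in>{0..<q}. ?e (?\<phi> n - ?\<phi> m))"
    unfolding gauss_sum_def cnj_sum sum_distrib_left sum_distrib_right of_int_diff diff_divide_distrib unit_exp_diff
    by (rule refl)
  also have "\<dots> = (\<Sum>m\<in>{0..<q}. \<Sum>d\<in>{0..<q}. ?e (?\<phi> (d + m) - ?\<phi> m))"
  proof (rule sum.cong[OF refl], rule sum_residues_shift[symmetric])
    fix m n
    show "?e (?\<phi> (n mod q) - ?\<phi> m) = ?e (?\<phi> n - ?\<phi> m)"
      by (intro unit_exp_frac_cong mod_diff_cong quadratic_mod refl)
  qed (use assms in auto)
  also have "\<dots> = (\<Sum>d\<in>{0..<q}. \<Sum>m\<in>{0..<q}. ?e (?\<phi> d) * ?e ((2 * p * d) * m))"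
    by (subst sum.swap, intro sum.cong refl)
       (simp add: algebra_simps power2_eq_square diff_divide_distrib add_divide_distrib flip: unit_exp_add)
  also have "\<dots> = (\<Sum>d\<in>{0..<q}. ?e (?\<phi> d) * (if q dvd 2 * p * d then of_int q else 0))"
    by (simp only: sum_unit_exp_residues[OF assms(1)] flip: sum_distrib_left)
  also have "\<dots> = (\<Sum>d\<in>{0..<q}. if q dvd 2 * d then ?e (?\<phi> d) * of_int q else 0)"
  proof (intro sum.cong refl)
    fix d
    have "q dvd 2 * p * d \<longleftrightarrow> q dvd 2 * d"
      using coprime_dvd_mult_right_iff[of q p "2 * d"] assms(2)
      by (simp add: coprime_commute mult.left_commute mult.assoc)
    then show "?e (?\<phi> d) * (if q dvd 2 * p * d then of_int q else 0) = (if q dvd 2 * d then ?e (?\<phi> d) * of_int q else 0)"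
      by simp
  qed
  also have "\<dots> = (\<Sum>d\<in>{d\<in>{0..<q}. q dvd 2 * d}. ?e (?\<phi> d) * of_int q)"
    by (rule sum.inter_filter[symmetric]) simp
  also have "{d\<in>{0..<q}. q dvd 2 * d} = (if even q then {0, q div 2} else {0})"
  proof -
    have "d = 0 \<or> 2 * d = q" if d: "0 \<le> d" "d < q" "q dvd 2 * d" for d
    proof -
      obtain k where k: "2 * d = q * k" using d(3) by blast
      then have "q * k < q * 2" "q * k \<ge> 0" using d by linarith+
      then have "k < 2" "k \<ge> 0" using assms(1) by (simp_all add: zero_le_mult_iff)
      then have "k = 0 \<or> k = 1" by linarith
      then show ?thesis using k by auto
    qed
    then have "{d\<in>{0..<q}. q dvd 2 * d} = {d. d = 0 \<or> 2 * d = q}"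
      using assms(1) by auto
    also have "\<dots> = (if even q then {0, q div 2} else {0})"
      by (cases "even q") (auto elim!: evenE)
    finally show ?thesis .
  qed
  finally have *: "complex_of_real ((norm (gauss_sum p q b))\<^sup>2)
    = (\<Sum>d\<in>(if even q then {0, q div 2} else {0}). ?e (?\<phi> d) * of_int q)" .
  show ?thesis
  proof (cases "even q")
    case True
    then obtain k where k: "q = 2 * k" by blast
    then have "k > 0" using assms by simp
    have phase: "of_int (?\<phi> (q div 2)) / real_of_int q = of_int (p * q) / 4 - of_int b / 2"
      using \<open>k > 0\<close> by (simp add: k field_simps power2_eq_square)
    have "(\<Sum>d\<in>{0, q div 2}. ?e (?\<phi> d) * of_int q)
        = of_int q * (1 + unit_exp (of_int (p * q) / 4 - of_int b / 2))"
      unfolding phase[symmetric] using \<open>k > 0\<close> by (simp add: k algebra_simps)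
    then show ?thesis
      using * True by (simp only: if_True)
  next
    case False
    then show ?thesis using * by simp
  qed
qed

lemma norm_gauss_sum_le:
  assumes "q > 0" "coprime p q"
  shows "norm (gauss_sum p q b) \<le> sqrt (2 * of_int q)"
proof -
  have "(norm (gauss_sum p q b))\<^sup>2 = norm (complex_of_real ((norm (gauss_sum p q b))\<^sup>2))"
    by (simp only: norm_of_real abs_power2)
  also have "\<dots> \<le> of_int q * (1 + 1)"
    unfolding norm_gauss_sum_squared[OF assms] using assms(1)
    by (auto simp: norm_mult intro!: norm_triangle_le)
  finally show ?thesis
    by (intro real_le_rsqrt) simp
qed

lemma norm_gauss_sum_ge:
  assumes "q > 0" "coprime p q" "\<not> twice_odd q"
  shows "sqrt (of_int q) \<le> norm (gauss_sum p q 0)"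
proof -
  \<comment> \<open>The squared modulus is q for odd q and 2q for q divisible by 4, where p q/4 is
    an integer; the two-element set treats both cases at once.\<close>
  have "complex_of_real (of_int q) \<in> {complex_of_real ((norm (gauss_sum p q 0))\<^sup>2),
      complex_of_real ((norm (gauss_sum p q 0))\<^sup>2 / 2)}"
  proof (cases "even q")
    case True
    then obtain k where k: "q = 2 * k" by blast
    then have "even k" using assms(3) by (auto simp: twice_odd_def)
    then obtain l where "k = 2 * l" by blast
    then have "of_int (p * q) / 4 - of_int 0 / 2 = real_of_int (p * l)"
      by (simp add: k)
    then have "unit_exp (of_int (p * q) / 4 - of_int 0 / 2) = 1"
      by (simp only: unit_exp_of_int)
    then have "complex_of_real ((norm (gauss_sum p q 0))\<^sup>2) = 2 * of_int q"
      using norm_gauss_sum_squared[OF assms(1,2), of 0] True by simp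
    then show ?thesis by simp
  qed (use norm_gauss_sum_squared[OF assms(1,2), of 0] in simp)
  then have "of_int q \<le> (norm (gauss_sum p q 0))\<^sup>2"
    unfolding insert_iff of_real_eq_iff using assms(1) by auto
  then show ?thesis
    by (simp add: real_le_lsqrt)
qed

text \<open>Coprimality to the even q makes p odd, so p q/4 is a half-integer and the two surviving
  terms of the squared modulus cancel.\<close>

lemma gauss_sum_twice_odd:
  assumes "q > 0" "coprime p q" "twice_odd q"
  shows "gauss_sum p q 0 = 0"
proof -
  obtain m where m: "odd m" "q = 2 * m" using assms(3) by (auto simp: twice_odd_def)
  then have "odd p" using assms(2) by (metis coprime_commute coprime_mult_left_iff coprime_left_2_iff_odd)
  then have "odd (p * m)" using m by simp
  then obtain k where "p * m = 2 * k + 1" by (rule oddE)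
  then have "real_of_int (p * m) = 2 * of_int k + 1" by simp
  then have "of_int (p * q) / 4 - of_int 0 / 2 = real_of_int k + 1 / 2"
    by (simp add: m(2) field_simps)
  moreover have "unit_exp (1 / 2) = -1"
    by (simp add: unit_exp_def)
  ultimately have "unit_exp (of_int (p * q) / 4 - of_int 0 / 2) = -1"
    by (simp only: unit_exp_add unit_exp_of_int) simp
  then show ?thesis
    using norm_gauss_sum_squared[OF assms(1,2), of 0] m(2) by simp
qed

section \<open>Approximation of incomplete quadratic sums\<close>

lemma sum_inverse_int_le:
  fixes q :: int
  assumes "q \<ge> 1"
  shows "(\<Sum>b\<in>{1..q}. 1 / real_of_int b) \<le> 1 + ln (of_int q)"
  using assms
proof (induction q rule: int_ge_induct)
  case (step q)
  have "{1..q + 1} = insert (q + 1) {1..q}" using step by auto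
  moreover have "ln (real_of_int q / (of_int q + 1)) \<le> of_int q / (of_int q + 1) - 1"
    using step by (intro ln_le_minus_one) auto
  then have "1 / (real_of_int q + 1) \<le> ln (of_int q + 1) - ln (of_int q)"
    using step by (simp add: ln_div field_simps)
  ultimately show ?case using step by (simp add: add.commute)
qed simp

lemma sum_inverse_pair_le:
  fixes q :: int
  assumes "q \<ge> 1"
  shows "(\<Sum>b\<in>{1..<q}. 1 / real_of_int b + 1 / of_int (q - b)) \<le> 2 * (1 + ln (of_int q))"
proof -
  have "(\<Sum>b\<in>{1..<q}. 1 / real_of_int (q - b)) = (\<Sum>b\<in>{1..<q}. 1 / real_of_int b)"
    by (rule sum.reindex_bij_witness[where i = "\<lambda>b. q - b" and j = "\<lambda>b. q - b"]) auto
  moreover have "(\<Sum>b\<in>{1..<q}. 1 / real_of_int b) \<le> (\<Sum>b\<in>{1..q}. 1 / real_of_int b)"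
    by (rule sum_mono2) auto
  ultimately show ?thesis
    using sum_inverse_int_le[OF assms] by (simp add: sum.distrib)
qed

text \<open>The increments differ from b/q by at most 1/(2q), so at least half of the distance from
  b/q to the integers survives; this is \<theta>. Replacing the inverse of the minimum by the sum of
  both inverses avoids splitting the later sum over b at q/2.\<close>

lemma shifted_quadratic_sum_le:
  fixes h :: real and b q :: int
  assumes "1 \<le> b" "b < q" "4 * of_int q * \<bar>h\<bar> * real N \<le> 1"
  shows "norm (\<Sum>n\<in>{M<..N}. unit_exp (h * real n ^ 2 + of_int b / of_int q * real n))
    \<le> 4 * of_int q * (1 / of_int b + 1 / of_int (q - b))"
proof -
  define \<theta> where "\<theta> = min (of_int b) (of_int (q - b)) / (2 * real_of_int q)"
  have bq: "real_of_int b \<ge> 1" "real_of_int q \<ge> real_of_int b + 1"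
    using assms by linarith+
  have "\<bar>h * (2 * real n + 1)\<bar> \<le> 1 / (2 * of_int q)" if "n < N" for n
  proof -
    have "\<bar>h * (2 * real n + 1)\<bar> \<le> \<bar>h\<bar> * (2 * real N)"
      unfolding abs_mult using that by (intro mult_left_mono) auto
    also have "\<bar>h\<bar> * (2 * real N) \<le> 1 / (2 * of_int q)"
      using assms(3) bq by (simp add: field_simps)
    finally show ?thesis .
  qed
  moreover have "\<theta> \<le> of_int b / of_int q - 1 / (2 * of_int q)"
  proof -
    have "\<theta> \<le> of_int b / (2 * of_int q)"
      unfolding \<theta>_def using bq by (intro divide_right_mono) auto
    also have "\<dots> \<le> of_int b / of_int q - 1 / (2 * of_int q)"
      using bq by (simp add: field_simps)
    finally show ?thesis .
  qed
  moreover have "of_int b / of_int q + 1 / (2 * of_int q) \<le> 1 - \<theta>"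
  proof -
    have "\<theta> \<le> (of_int q - of_int b) / (2 * of_int q)"
      unfolding \<theta>_def using bq by (intro divide_right_mono) auto
    also have "\<dots> \<le> (2 * of_int q - 2 * of_int b - 1) / (2 * of_int q)"
      using bq by (intro divide_right_mono) auto
    also have "\<dots> = 1 - (of_int b / of_int q + 1 / (2 * of_int q))"
      using bq by (simp add: field_simps)
    finally show ?thesis by linarith
  qed
  ultimately have "\<theta> \<le> h * (2 * real n + 1) + of_int b / of_int q
      \<and> h * (2 * real n + 1) + of_int b / of_int q \<le> 1 - \<theta>" if "n < N" for n
    using that by (force simp: abs_le_iff)
  moreover have "0 < \<theta>" "\<theta> \<le> 1"
    using bq by (auto simp: \<theta>_def field_simps min_def)
  ultimately have "norm (\<Sum>n\<in>{M<..N}. unit_exp (h * real n ^ 2 + of_int b / of_int q * real n)) \<le> 2 / \<theta>"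
    by (intro kusmin_landau_quadratic) auto
  also have "2 / \<theta> \<le> 4 * of_int q * (1 / of_int b + 1 / of_int (q - b))"
  proof -
    have "2 / \<theta> = 4 * of_int q * (1 / min (of_int b) (of_int (q - b)))"
      using bq by (simp add: \<theta>_def)
    also have "\<dots> \<le> 4 * of_int q * (1 / of_int b + 1 / of_int (q - b))"
      using bq by (intro mult_left_mono) (auto simp: min_def)
    finally show ?thesis .
  qed
  finally show ?thesis .
qed

text \<open>Expanding the phase \<open>p n\<^sup>2 / q\<close> over the additive characters modulo \<open>q\<close>, every nonzero
  frequency is removed by the Kusmin--Landau inequality; only the complete Gauss sum survives.\<close>

lemma quadratic_sum_approx:
  fixes h :: real and p q :: int
  assumes "q > 0" "coprime p q" "4 * of_int q * \<bar>h\<bar> * real N \<le> 1"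
  shows "norm ((\<Sum>n\<in>{M<..N}. unit_exp (real n ^ 2 * (of_int p / of_int q + h)))
      - gauss_sum p q 0 / of_int q * (\<Sum>n\<in>{M<..N}. unit_exp (h * real n ^ 2)))
    \<le> 12 * sqrt (of_int q) * (1 + ln (of_int q))"
proof -
  define T where "T b = (\<Sum>n\<in>{M<..N}. unit_exp (h * real n ^ 2 + of_int b / of_int q * real n))" for b :: int
  have expand: "unit_exp (real n ^ 2 * (of_int p / of_int q + h)) = (\<Sum>b\<in>{0..<q}. gauss_sum p q b / of_int q *
      unit_exp (h * real n ^ 2 + of_int b / of_int q * real n))" for n :: nat
  proof -
    have "unit_exp (real n ^ 2 * (of_int p / of_int q + h)) =
        unit_exp (of_int (p * (int n)\<^sup>2) / of_int q) * unit_exp (h * real n ^ 2)"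
      by (simp add: algebra_simps flip: unit_exp_add)
    then show ?thesis
      unfolding quadratic_phase_eq_gauss_sum[OF assms(1)]
      by (simp add: sum_divide_distrib sum_distrib_left sum_distrib_right unit_exp_add mult_ac)
  qed
  have "(\<Sum>n\<in>{M<..N}. unit_exp (real n ^ 2 * (of_int p / of_int q + h)))
      = (\<Sum>b\<in>{0..<q}. gauss_sum p q b / of_int q * T b)"
    unfolding expand T_def sum_distrib_left by (rule sum.swap)
  also have "{0..<q} = insert 0 {1..<q}" using assms(1) by auto
  finally have "(\<Sum>n\<in>{M<..N}. unit_exp (real n ^ 2 * (of_int p / of_int q + h)))
      - gauss_sum p q 0 / of_int q * T 0 = (\<Sum>b\<in>{1..<q}. gauss_sum p q b / of_int q * T b)"
    by simp
  also have "norm \<dots> \<le> (\<Sum>b\<in>{1..<q}. sqrt (2 * of_int q) / of_int q * (4 * of_int q * (1 / of_int b + 1 / of_int (q - b))))"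
  proof (rule sum_norm_le)
    fix b assume "b \<in> {1..<q}"
    then have "norm (T b) \<le> 4 * of_int q * (1 / of_int b + 1 / of_int (q - b))"
      unfolding T_def using assms(3) by (intro shifted_quadratic_sum_le) auto
    moreover have "norm (gauss_sum p q b / of_int q) \<le> sqrt (2 * of_int q) / of_int q"
      using norm_gauss_sum_le[OF assms(1,2), of b] assms(1) by (simp add: norm_divide divide_right_mono)
    ultimately show "norm (gauss_sum p q b / of_int q * T b) \<le>
        sqrt (2 * of_int q) / of_int q * (4 * of_int q * (1 / of_int b + 1 / of_int (q - b)))"
      unfolding norm_mult using assms(1) by (intro mult_mono) auto
  qed
  \<comment> \<open>The 1/q of Fourier inversion cancels the factor q in the bound for each
    frequency, leaving sqrt q times a harmonic sum.\<close>
  also have "\<dots> = 4 * sqrt (2 * of_int q) * (\<Sum>b\<in>{1..<q}. 1 / of_int b + 1 / of_int (q - b))"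
    unfolding sum_distrib_left using assms(1) by (intro sum.cong refl) simp
  also have "\<dots> \<le> 4 * sqrt (2 * of_int q) * (2 * (1 + ln (of_int q)))"
    using assms(1) by (intro mult_left_mono sum_inverse_pair_le) auto
  also have "\<dots> = (8 * sqrt 2) * (sqrt (of_int q) * (1 + ln (of_int q)))"
    by (simp add: real_sqrt_mult)
  also have "\<dots> \<le> 12 * (sqrt (of_int q) * (1 + ln (of_int q)))"
  proof (rule mult_right_mono)
    have "sqrt 2 \<le> 3 / 2" by (rule real_le_lsqrt) (auto simp: power2_eq_square)
    then show "8 * sqrt 2 \<le> 12" by simp
  qed (use assms(1) in auto)
  finally show ?thesis by (simp add: T_def)
qed

section \<open>Comparison of power sums with integrals\<close>

lemma sum_powr_le:
  assumes "0 < s" "s < 1"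
  shows "(\<Sum>n\<in>{1..N}. real n powr (- s)) \<le> real N powr (1 - s) / (1 - s)"
proof (induction N)
  case (Suc N)
  show ?case
  proof (cases "N = 0")
    \<comment> \<open>The interval from 0 to 1 is treated apart, as the power is not differentiable
      at 0: its single term is 1 <= 1/(1 - s).\<close>
    case True
    then show ?thesis using assms by (simp add: field_simps)
  next
    case False
    obtain z where z: "real N < z" "z < real N + 1"
      "(real N + 1) powr (1 - s) - real N powr (1 - s) = (real N + 1 - real N) * ((1 - s) * z powr (1 - s - 1))"
    proof -
      have "\<exists>z>real N. z < real N + 1 \<and> (real N + 1) powr (1 - s) - real N powr (1 - s)
          = (real N + 1 - real N) * ((1 - s) * z powr (1 - s - 1))"
        by (rule MVT2) (use False in \<open>auto intro!: has_real_derivative_powr'[THEN DERIV_cong] derivative_eq_intros\<close>)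
      then show ?thesis using that by blast
    qed
    have "(real N + 1) powr (- s) \<le> z powr (- s)"
      using z assms by (intro powr_mono2') auto
    then have "(1 - s) * (real N + 1) powr (- s) \<le> (real N + 1) powr (1 - s) - real N powr (1 - s)"
      using z assms by (simp add: mult_left_mono)
    then show ?thesis
      using Suc assms by (simp add: field_simps)
  qed
qed simp

lemma sum_inverse_le_ln:
  assumes "0 < M" "M \<le> N"
  shows "(\<Sum>n\<in>{M<..N}. 1 / real n) \<le> ln (N / M)"
  using assms(2)
proof (induction N rule: dec_induct)
  case (step N)
  have "{M<..Suc N} = insert (Suc N) {M<..N}" using step by auto
  moreover have "ln (real N / (real N + 1)) \<le> real N / (real N + 1) - 1"
    using step assms by (intro ln_le_minus_one) auto
  then have "1 / (real N + 1) \<le> ln (real N + 1) - ln (real N)"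
    using step assms by (simp add: ln_div field_simps)
  ultimately show ?case using step assms by (simp add: ln_div add.commute)
qed (use assms in simp)

text \<open>Each 1/n is at least ln (n + 1) - ln n; the resulting shift of both endpoints keeps the
  bound meaningful for M = 0.\<close>

lemma sum_inverse_ge_ln:
  assumes "M \<le> N"
  shows "ln ((real N + 1) / (real M + 1)) \<le> (\<Sum>n\<in>{M<..N}. 1 / real n)"
  using assms
proof (induction N rule: dec_induct)
  case (step N)
  have "{M<..Suc N} = insert (Suc N) {M<..N}" using step by auto
  moreover have "ln ((real N + 2) / (real N + 1)) \<le> (real N + 2) / (real N + 1) - 1"
    by (intro ln_le_minus_one) auto
  then have "ln (real N + 2) - ln (real N + 1) \<le> 1 / (real N + 1)"
    by (simp add: ln_div field_simps)
  ultimately show ?case using step by (simp add: ln_div add.commute)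
qed simp

section \<open>Convergents\<close>

lemma cfrac_quot_unfold: "cfrac_quot x n = of_int (cfrac_coeff x n) + 1 / cfrac_quot x (Suc n)"
  by (simp add: cfrac_coeff_def frac_def)

lemma cfrac_quot_pos:
  assumes "x \<notin> \<rat>"
  shows "cfrac_quot x (Suc n) > 0"
  using cfrac_coeff_pos[OF assms, of n] unfolding cfrac_coeff_def le_floor_iff by linarith

text \<open>Cleared of denominators, this says that x is the continued fraction
  [a_0; ..., a_{n+1}, v] whose last entry is the complete quotient v. Since u = a + 1/v for
  consecutive complete quotients u and v, the induction step multiplies both sides by v.\<close>

lemma conv_complete_quotient:
  assumes "x \<notin> \<rat>"
  shows "x * (cfrac_quot x (Suc (Suc n)) * conv_denom x (Suc n) + conv_denom x n)
    = cfrac_quot x (Suc (Suc n)) * conv_num x (Suc n) + conv_num x n"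
proof (induction n)
  case 0
  define u v where "u = cfrac_quot x (Suc 0)" and "v = cfrac_quot x (Suc (Suc 0))"
  have "u > 0" "v > 0"
    unfolding u_def v_def by (rule cfrac_quot_pos[OF assms])+
  have "x = of_int (cfrac_coeff x 0) + 1 / u" "u = of_int (cfrac_coeff x 1) + 1 / v"
    using cfrac_quot_unfold[of x 0] cfrac_quot_unfold[of x 1]
    unfolding u_def v_def One_nat_def cfrac_quot.simps(1) by auto
  then have a: "real_of_int (cfrac_coeff x 0) = x - 1 / u" "real_of_int (cfrac_coeff x 1) = u - 1 / v"
    by linarith+
  have "x * (v * (u - 1 / v) + 1) = v * ((u - 1 / v) * (x - 1 / u) + 1) + (x - 1 / u)"
    using \<open>u > 0\<close> \<open>v > 0\<close> by (simp add: field_simps)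
  then show ?case
    unfolding v_def[symmetric] using a by simp
next
  case (Suc n)
  define u v where "u = cfrac_quot x (Suc (Suc n))" and "v = cfrac_quot x (Suc (Suc (Suc n)))"
  have "v > 0" unfolding v_def by (rule cfrac_quot_pos[OF assms])
  have "u = of_int (cfrac_coeff x (Suc (Suc n))) + 1 / v"
    unfolding u_def v_def by (rule cfrac_quot_unfold)
  then have a: "real_of_int (cfrac_coeff x (Suc (Suc n))) = u - 1 / v" by simp
  have "x * (u * conv_denom x (Suc n) + conv_denom x n) = u * conv_num x (Suc n) + conv_num x n"
    using Suc unfolding u_def .
  moreover have "v * conv_denom x (Suc (Suc n)) + conv_denom x (Suc n) = v * (u * conv_denom x (Suc n) + conv_denom x n)"
    "v * conv_num x (Suc (Suc n)) + conv_num x (Suc n) = v * (u * conv_num x (Suc n) + conv_num x n)"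
    using \<open>v > 0\<close> by (simp_all add: a field_simps)
  ultimately show ?case
    unfolding v_def[symmetric] by (simp only: mult.left_commute)
qed

lemma conv_denom_mono:
  assumes "x \<notin> \<rat>"
  shows "conv_denom x n \<le> conv_denom x (Suc n)"
proof (cases n)
  case 0
  then show ?thesis using cfrac_coeff_pos[OF assms, of 0] by simp
next
  case (Suc m)
  have "1 * conv_denom x (Suc m) \<le> cfrac_coeff x (Suc (Suc m)) * conv_denom x (Suc m)"
    using cfrac_coeff_pos[OF assms, of "Suc m"] conv_denom_pos[OF assms, of "Suc m"] by (intro mult_right_mono) auto
  then show ?thesis using conv_denom_pos[OF assms, of m] Suc by simp
qed

text \<open>The recurrence gives q_{n+2} >= q_{n+1} + q_n >= 2 q_n. This geometric growth makes sums
  over j of negative powers of q_j finite.\<close>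

lemma two_power_le_conv_denom:
  assumes "x \<notin> \<rat>"
  shows "2 ^ (n div 2) \<le> conv_denom x n"
proof (induction n rule: less_induct)
  case (less n)
  consider "n < 2" | m where "n = Suc (Suc m)"
    by (metis add_2_eq_Suc le_iff_add not_less)
  then show ?case
  proof cases
    case 1
    then show ?thesis using conv_denom_pos[OF assms, of n] by simp
  next
    case 2
    have "1 * conv_denom x (Suc m) \<le> cfrac_coeff x (Suc (Suc m)) * conv_denom x (Suc m)"
      using cfrac_coeff_pos[OF assms, of "Suc m"] conv_denom_pos[OF assms, of "Suc m"] by (intro mult_right_mono) auto
    then have "2 * conv_denom x m \<le> conv_denom x n"
      using conv_denom_mono[OF assms, of m] 2 by simp
    then show ?thesis using less[of m] 2 by simp
  qed
qed

lemma conv_denom_at_top: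
  assumes "x \<notin> \<rat>"
  shows "filterlim (\<lambda>n. real_of_int (conv_denom x n)) at_top sequentially"
proof (rule filterlim_at_top_mono)
  show "filterlim (\<lambda>n. real n / 2 - 1) at_top sequentially"
    by real_asymp
  have "real n / 2 - 1 \<le> of_int (conv_denom x n)" for n
  proof -
    have "int (n div 2) < 2 ^ (n div 2)"
      by (metis less_exp of_nat_less_iff of_nat_numeral of_nat_power)
    then have "int (n div 2) \<le> conv_denom x n"
      using two_power_le_conv_denom[OF assms, of n] by linarith
    then show ?thesis by linarith
  qed
  then show "\<forall>\<^sub>F n in sequentially. real n / 2 - 1 \<le> of_int (conv_denom x n)"
    by simp
qed

text \<open>The error is exactly 1/(q_j D) with D = v q_j + q_{j-1} and v the complete quotient of
  index j + 1. As v lies between a_{j+1} and a_{j+1} + 1, D lies between q_{j+1} and q_{j+1} + q_j,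
  hence below 2 q_{j+1}.\<close>

lemma conv_error_bounds:
  assumes "x \<notin> \<rat>" "j \<ge> 1"
  defines "h \<equiv> \<bar>x - conv_num x j / conv_denom x j\<bar>"
  shows "1 / (2 * (real_of_int (conv_denom x j) * conv_denom x (Suc j))) \<le> h"
    and "h \<le> 1 / (real_of_int (conv_denom x j) * conv_denom x (Suc j))"
proof -
  obtain n where j: "j = Suc n" using assms(2) by (cases j) auto
  define v q r where "v = cfrac_quot x (Suc (Suc n))" and "q = real_of_int (conv_denom x (Suc n))"
    and "r = real_of_int (conv_denom x n)"
  define D where "D = v * q + r"
  define q' where "q' = real_of_int (conv_denom x (Suc (Suc n)))"
  have pos: "v > 0" "q > 0" "r > 0" "q' > 0"
    using cfrac_quot_pos[OF assms(1), of "Suc n"] conv_denom_pos[OF assms(1)]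
    unfolding v_def q_def r_def q'_def of_int_0_less_iff by blast+
  then have "D > 0" by (simp add: D_def add_pos_pos)
  have "real_of_int (conv_num x (Suc n) * conv_denom x n - conv_num x n * conv_denom x (Suc n)) = of_int ((-1) ^ n)"
    by (simp only: conv_det)
  then have det: "real_of_int (conv_num x (Suc n)) * r - of_int (conv_num x n) * q = (-1) ^ n"
    by (simp add: q_def r_def)
  have "x * D = v * conv_num x (Suc n) + conv_num x n"
    unfolding D_def v_def q_def r_def by (rule conv_complete_quotient[OF assms(1)])
  moreover have "(x * q - conv_num x (Suc n)) * D = q * (x * D) - conv_num x (Suc n) * D"
    by (simp add: algebra_simps)
  ultimately have "(x * q - conv_num x (Suc n)) * D = q * (v * conv_num x (Suc n) + conv_num x n) - conv_num x (Suc n) * D"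
    by simp
  also have "\<dots> = - ((-1) ^ n)"
    using det by (simp add: D_def algebra_simps)
  finally have "(x * q - conv_num x (Suc n)) * D = - ((-1) ^ n)" .
  moreover have "x - conv_num x (Suc n) / q = (x * q - conv_num x (Suc n)) * D / (q * D)"
    using pos \<open>D > 0\<close> by (simp add: field_simps)
  ultimately have "x - conv_num x (Suc n) / q = - ((-1) ^ n) / (q * D)"
    by simp
  then have h: "h = 1 / (q * D)"
    using pos \<open>D > 0\<close> by (simp add: h_def j q_def abs_mult)
  have "of_int (cfrac_coeff x (Suc (Suc n))) \<le> v" "v \<le> of_int (cfrac_coeff x (Suc (Suc n))) + 1"
    unfolding cfrac_coeff_def v_def by linarith+
  then have "of_int (cfrac_coeff x (Suc (Suc n))) * q \<le> v * q" "v * q \<le> (of_int (cfrac_coeff x (Suc (Suc n))) + 1) * q"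
    using pos by (auto intro: mult_right_mono)
  moreover have "q' = of_int (cfrac_coeff x (Suc (Suc n))) * q + r"
    by (simp add: q'_def q_def r_def)
  moreover have "q \<le> q'"
    using conv_denom_mono[OF assms(1), of "Suc n"] unfolding q_def q'_def of_int_le_iff .
  ultimately have "q' \<le> D" "D \<le> 2 * q'"
    by (auto simp: D_def algebra_simps)
  then have "1 / (2 * (q * q')) \<le> h" "h \<le> 1 / (q * q')"
    unfolding h using pos \<open>D > 0\<close> by (auto intro!: divide_left_mono)
  then show "1 / (2 * (real_of_int (conv_denom x j) * conv_denom x (Suc j))) \<le> h"
    "h \<le> 1 / (real_of_int (conv_denom x j) * conv_denom x (Suc j))"
    by (simp_all only: j q_def q'_def)
qed

text \<open>By the determinant identity two consecutive denominators cannot both be even, and an odd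
  denominator is admissible.\<close>

lemma infinite_adm_indices:
  assumes "x \<notin> \<rat>"
  shows "\<exists>j\<ge>m. j \<in> adm_indices x"
proof -
  have "odd (conv_denom x (Suc m)) \<or> odd (conv_denom x (Suc (Suc m)))"
  proof (rule ccontr)
    assume "\<not> ?thesis"
    then have "even (conv_num x (Suc (Suc m)) * conv_denom x (Suc m) - conv_num x (Suc m) * conv_denom x (Suc (Suc m)))"
      by simp
    then show False unfolding conv_det by simp
  qed
  then have "Suc m \<in> adm_indices x \<or> Suc (Suc m) \<in> adm_indices x"
    by (auto simp: adm_indices_def twice_odd_def simp del: conv_denom.simps)
  then show ?thesis by (meson le_SucI le_refl)
qed

lemma summable_conv_denom_powr:
  assumes "x \<notin> \<rat>" "\<delta> > 0"
  shows "summable (\<lambda>j. real_of_int (conv_denom x j) powr (- \<delta>))"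
proof (rule summable_comparison_test')
  define c where "c = 2 powr (- \<delta> / 2)"
  have "c < 1" using assms(2) by (simp add: c_def powr_less_one)
  then show "summable (\<lambda>j. 2 powr \<delta> * c ^ j)"
    by (intro summable_mult summable_geometric) (simp add: c_def)
  fix j :: nat
  have "real j / 2 - 1 \<le> real (j div 2)" by linarith
  then have "(2::real) powr (real j / 2 - 1) \<le> 2 powr (real (j div 2))" by simp
  also have "\<dots> = of_int (2 ^ (j div 2))" by (simp add: powr_realpow)
  also have "\<dots> \<le> of_int (conv_denom x j)"
    using two_power_le_conv_denom[OF assms(1)] by (simp only: of_int_le_iff)
  finally have "real_of_int (conv_denom x j) powr (- \<delta>) \<le> (2 powr (real j / 2 - 1)) powr (- \<delta>)"
    using assms(2) by (intro powr_mono2') auto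
  also have "\<dots> = 2 powr \<delta> * c ^ j"
    by (simp add: c_def powr_powr flip: powr_add powr_realpow) (simp add: algebra_simps)
  finally show "norm (real_of_int (conv_denom x j) powr (- \<delta>)) \<le> 2 powr \<delta> * c ^ j" by simp
qed

section \<open>Weighted sums of a slowly varying quadratic phase\<close>

text \<open>Used with h = x, where it is a difference of partial sums of the series, and with h = x
  - p/q, where it is the slowly varying model.\<close>

definition weighted_sum :: "real \<Rightarrow> real \<Rightarrow> nat \<Rightarrow> nat \<Rightarrow> complex" where
  "weighted_sum s h M N = (\<Sum>n\<in>{M<..N}. (real n powr - s) *\<^sub>R unit_exp (h * real n ^ 2))"

lemma norm_weighted_sum_le: "norm (weighted_sum s h M N) \<le> (\<Sum>n\<in>{M<..N}. real n powr - s)"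
  unfolding weighted_sum_def by (rule sum_norm_le) simp

lemma F_partial_diff:
  assumes "M \<le> N"
  shows "F_partial s x N - F_partial s x M = weighted_sum s x M N"
proof -
  have "exp (2 * \<i> * of_real pi * of_nat n ^ 2 * of_real x) / of_real (real n powr s)
      = (real n powr - s) *\<^sub>R unit_exp (x * real n ^ 2)" for n
    by (simp add: unit_exp_def cis_conv_exp powr_minus scaleR_conv_of_real divide_inverse mult_ac)
  moreover have "{1..N} = {1..M} \<union> {M<..N}" using assms by auto
  moreover have "{1..M} \<inter> {M<..N} = {}" by auto
  ultimately show ?thesis
    by (simp add: F_partial_def weighted_sum_def sum.union_disjoint)
qed

text \<open>Past K the increments |h| (2n + 1) are at least |h| K and at most 1/2, so the
  Kusmin--Landau bound applies with \<theta> = |h| K. When |h| has order 1/K^2, the result has order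
  K^{1-s}, the size of the part below K.\<close>

lemma weighted_sum_tail_bound:
  assumes "h \<noteq> 0" "4 * \<bar>h\<bar> * real N \<le> 1" "0 < K" "K \<le> real M + 1" "0 < s"
  shows "norm (weighted_sum s h M N) \<le> K powr (- s) * (2 / (\<bar>h\<bar> * K))"
proof (cases "M < N")
  case False
  then show ?thesis using assms by (simp add: weighted_sum_def)
next
  case True
  \<comment> \<open>For negative h the increments are negative; adding the integer n to the phase
    moves them into the unit interval.\<close>
  define c :: real where "c = (if h > 0 then 0 else 1)"
  have phase: "unit_exp (h * real n ^ 2) = unit_exp (h * real n ^ 2 + c * real n)" for n
    by (rule unit_exp_cong) (simp add: c_def)
  have hK: "\<bar>h\<bar> * K \<le> \<bar>h\<bar> * real N"
    using True assms by (intro mult_left_mono) auto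
  then have hK1: "\<bar>h\<bar> * K \<le> 1"
    using assms(2) by linarith
  have "norm (\<Sum>n\<in>{M<..k}. unit_exp (h * real n ^ 2)) \<le> 2 / (\<bar>h\<bar> * K)" if "k \<le> N" for k
    unfolding phase
  proof (rule kusmin_landau_quadratic)
    fix n assume n: "M < n" "n < k"
    define a where "a = \<bar>h\<bar> * (2 * real n + 1)"
    have "a \<le> \<bar>h\<bar> * (2 * real N)" "\<bar>h\<bar> * K \<le> a"
      unfolding a_def using n that assms by (intro mult_left_mono; simp)+
    then have "\<bar>h\<bar> * K \<le> a" "a + \<bar>h\<bar> * K \<le> 1"
      using hK assms(2) by linarith+
    moreover have "h * (2 * real n + 1) = (if h > 0 then a else - a)"
      by (simp add: a_def)
    ultimately show "\<bar>h\<bar> * K \<le> h * (2 * real n + 1) + c \<and> h * (2 * real n + 1) + c \<le> 1 - \<bar>h\<bar> * K"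
      by (simp only: c_def split: if_split) linarith
  qed (use hK1 assms in auto)
  then have "norm (weighted_sum s h M N) \<le> real (Suc M) powr (- s) * (2 / (\<bar>h\<bar> * K))"
    unfolding weighted_sum_def using True assms
    by (intro sum_mult_abel_bound) (auto intro!: powr_mono2')
  also have "\<dots> \<le> K powr (- s) * (2 / (\<bar>h\<bar> * K))"
    using assms by (intro mult_right_mono powr_mono2') auto
  finally show ?thesis .
qed

lemma weighted_sum_split:
  assumes "M \<le> L" "L \<le> N"
  shows "weighted_sum s h M N = weighted_sum s h M L + weighted_sum s h L N"
proof -
  have "{M<..N} = {M<..L} \<union> {L<..N}" using assms by auto
  moreover have "{M<..L} \<inter> {L<..N} = {}" by auto
  ultimately show ?thesis by (simp add: weighted_sum_def sum.union_disjoint)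
qed

text \<open>At \<open>s = 1\<close> the term \<open>1 / (1 - s)\<close> is \<open>0\<close>, and the logarithm takes its place.\<close>

lemma weighted_sum_le:
  fixes q q' K :: real
  assumes s: "0 < s" "s \<le> 1" and q: "1 \<le> q" "q \<le> q'" and K: "K = sqrt (q * q')"
    and h: "1 / (2 * (q * q')) \<le> \<bar>h\<bar>" "4 * \<bar>h\<bar> * real N \<le> 1"
    and MN: "M \<le> N" "q \<le> 4 * (real M + 1)"
  shows "norm (weighted_sum s h M N)
    \<le> (7 + 1 / (1 - s)) * ((if s = 1 then ln (q' / q) else 1) * K powr (1 - s) + 1)"
proof -
  \<comment> \<open>The point K, where oscillation sets in, clamped to the range from M to
    N.\<close>
  define L where "L = min N (max M (nat \<lfloor>K\<rfloor>))"
  have L: "M \<le> L" "L \<le> N" using MN by (auto simp: L_def)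
  have K2: "K * K = q * q'" using q by (simp add: K)
  have "K \<ge> 1" unfolding K using q mult_mono[of 1 q 1 q'] by simp
  have "h \<noteq> 0"
  proof
    assume "h = 0"
    then have "q * q' \<le> 0" using h q by (simp add: divide_le_0_iff)
    then show False using K2 \<open>K \<ge> 1\<close> by (metis less_le_trans mult_pos_pos not_less zero_less_one)
  qed
  have tail: "norm (weighted_sum s h L N) \<le> 4 * K powr (1 - s)"
  proof (cases "L = N")
    case True
    then show ?thesis by (simp add: weighted_sum_def)
  next
    case False
    then have "L \<ge> nat \<lfloor>K\<rfloor>" by (auto simp: L_def)
    then have "K \<le> real L + 1" by linarith
    then have "norm (weighted_sum s h L N) \<le> K powr (- s) * (2 / (\<bar>h\<bar> * K))"
      using \<open>h \<noteq> 0\<close> \<open>K \<ge> 1\<close> h s by (intro weighted_sum_tail_bound) auto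
    also have "\<dots> \<le> K powr (- s) * (4 * K)"
    proof (rule mult_left_mono)
      have "1 \<le> 2 * (K * K) * \<bar>h\<bar>"
        using h(1) \<open>K \<ge> 1\<close> unfolding K2[symmetric] by (simp add: field_simps)
      then show "2 / (\<bar>h\<bar> * K) \<le> 4 * K"
        using \<open>h \<noteq> 0\<close> \<open>K \<ge> 1\<close> by (simp add: field_simps)
    qed simp
    also have "\<dots> = 4 * K powr (1 - s)"
      using \<open>K \<ge> 1\<close> by (simp add: powr_diff powr_minus field_simps)
    finally show ?thesis .
  qed
  have head: "norm (weighted_sum s h M L) \<le> (if s = 1 then 3 + ln (q' / q) else K powr (1 - s) / (1 - s))"
  proof (cases "M = L")
    case True
    then show ?thesis using s q by (auto simp: weighted_sum_def)
  next
    case False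
    then have "L \<le> nat \<lfloor>K\<rfloor>" "M < L" using L by (auto simp: L_def)
    then have "real L \<le> K" using \<open>K \<ge> 1\<close> by linarith
    show ?thesis
    proof (cases "s = 1")
      case True
      \<comment> \<open>M may be 0, so the first term is split off and the logarithm starts at M +
        1, which is at least q/4. Since K/q = sqrt (q'/q), this costs only 1 + ln 4 beyond half of
        ln (q'/q).\<close>
      have "{M<..L} = insert (Suc M) {Suc M<..L}" using \<open>M < L\<close> by auto
      then have "(\<Sum>n\<in>{M<..L}. real n powr - s) = 1 / (real M + 1) + (\<Sum>n\<in>{Suc M<..L}. 1 / real n)"
        by (simp add: True powr_minus divide_inverse add.commute)
      also have "\<dots> \<le> 1 + ln (real L / real (Suc M))"
        using \<open>M < L\<close> by (intro add_mono sum_inverse_le_ln) auto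
      also have "real L / real (Suc M) \<le> K / (q / 4)"
        using \<open>real L \<le> K\<close> MN q by (intro frac_le) auto
      then have "ln (real L / real (Suc M)) \<le> ln (K / (q / 4))"
        using \<open>M < L\<close> by (intro ln_mono) auto
      also have "ln (K / (q / 4)) = ln 4 + ln (q' / q) / 2"
        using q by (simp add: K ln_div ln_mult ln_sqrt field_simps)
      also have "ln 4 \<le> (2::real)"
        using ln_2_less_1 ln_mult[of 2 "2::real"] by simp
      also have "ln (q' / q) / 2 \<le> ln (q' / q)" using q by simp
      finally show ?thesis
        using norm_weighted_sum_le[of s h M L] True by simp
    next
      case False
      have "(\<Sum>n\<in>{M<..L}. real n powr - s) \<le> (\<Sum>n\<in>{1..L}. real n powr - s)"
        by (rule sum_mono2) auto
      also have "\<dots> \<le> real L powr (1 - s) / (1 - s)"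
        using s False by (intro sum_powr_le) auto
      also have "\<dots> \<le> K powr (1 - s) / (1 - s)"
        using \<open>real L \<le> K\<close> s by (intro divide_right_mono powr_mono2) auto
      finally show ?thesis
        using norm_weighted_sum_le[of s h M L] False by simp
    qed
  qed
  have "norm (weighted_sum s h M N) \<le> (if s = 1 then 3 + ln (q' / q) else K powr (1 - s) / (1 - s)) + 4 * K powr (1 - s)"
    unfolding weighted_sum_split[OF L] using head tail by (intro norm_triangle_le add_mono)
  \<comment> \<open>At s = 1 the constant is 3 from below K plus 4 from the tail. The summand +1 is
    what carries it, as ln (q'/q) can be arbitrarily small.\<close>
  also have "\<dots> \<le> (7 + 1 / (1 - s)) * ((if s = 1 then ln (q' / q) else 1) * K powr (1 - s) + 1)"
  proof (cases "s = 1")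
    case True
    then show ?thesis using \<open>K \<ge> 1\<close> q by simp
  next
    case False
    then have "1 / (1 - s) > 0" "K powr (1 - s) \<ge> 0" using s by auto
    moreover have "K powr (1 - s) / (1 - s) = 1 / (1 - s) * K powr (1 - s)" by simp
    ultimately show ?thesis using False
      by (simp only: if_False distrib_left distrib_right mult_1_right mult_1)
  qed
  finally show ?thesis .
qed

text \<open>All angles are at most \<pi>/8 in modulus, hence below \<pi>/3, so every cosine is at
  least 1/2 and nothing cancels in the real part.\<close>

lemma norm_weighted_sum_ge:
  assumes "\<bar>h\<bar> * real N ^ 2 \<le> 1 / 16"
  shows "(\<Sum>n\<in>{M<..N}. real n powr - s) / 2 \<le> norm (weighted_sum s h M N)"
proof -
  have "(\<Sum>n\<in>{M<..N}. real n powr - s) / 2 = (\<Sum>n\<in>{M<..N}. real n powr - s * (1 / 2))"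
    by (simp add: sum_divide_distrib)
  also have "\<dots> \<le> Re (weighted_sum s h M N)"
    unfolding weighted_sum_def Re_sum
  proof (rule sum_mono)
    fix n assume "n \<in> {M<..N}"
    then have "\<bar>h\<bar> * real n ^ 2 \<le> \<bar>h\<bar> * real N ^ 2"
      by (intro mult_left_mono power_mono) auto
    then have "pi * (\<bar>h\<bar> * real n ^ 2) \<le> pi * (1 / 16)"
      using assms by (intro mult_left_mono) auto
    then have "cos (pi / 3) \<le> cos \<bar>2 * pi * (h * real n ^ 2)\<bar>"
      using pi_gt_zero by (intro cos_monotone_0_pi_le) (auto simp: abs_mult)
    then have "1 / 2 \<le> cos (2 * pi * (h * real n ^ 2))"
      by (simp add: cos_60)
    then have "real n powr - s * (1 / 2) \<le> real n powr - s * cos (2 * pi * (h * real n ^ 2))"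
      by (rule mult_left_mono) simp
    then show "real n powr - s * (1 / 2) \<le> Re (real n powr - s *\<^sub>R unit_exp (h * real n ^ 2))"
      by (simp add: unit_exp_def)
  qed
  also have "\<dots> \<le> norm (weighted_sum s h M N)"
    by (rule complex_Re_le_cmod)
  finally show ?thesis .
qed

text \<open>Stopping at K/4 is meant for |h| <= 1/K^2, which gives |h| N^2 <= 1/16. The subtracted
  power of M covers the short range K < 8 M, where the left side is not positive; divided by sqrt M
  it has the size of an admissible error.\<close>

lemma sum_powr_ge:
  fixes q' K :: real and M N :: nat
  assumes s: "0 < s" "s \<le> 1" and q: "1 \<le> M" "real M \<le> q'" and K: "K = sqrt (real M * q')"
    and N: "N = nat \<lfloor>K / 4\<rfloor>"
  shows "(if s = 1 then ln (q' / real M) else 1) * K powr (1 - s) / 8 - 4 * real M powr (1 - s)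
    \<le> (\<Sum>n\<in>{M<..N}. real n powr - s)"
proof -
  have "K > 0" using q by (simp add: K)
  have lnK: "ln (q' / real M) = 2 * ln (K / real M)"
    using q by (simp add: K ln_div ln_mult ln_sqrt field_simps)
  have ln8: "ln 8 \<le> (3::real)"
    using ln_2_less_1 ln_realpow[of 2 3] by simp
  show ?thesis
  proof (cases "K < 8 * real M")
    case True
    have "(if s = 1 then ln (q' / real M) else 1) * K powr (1 - s) / 8 \<le> real M powr (1 - s)"
    proof (cases "s = 1")
      case True
      have "ln (K / real M) \<le> ln 8"
        using \<open>K < 8 * real M\<close> \<open>K > 0\<close> q by (intro ln_mono) (auto simp: field_simps)
      then have "ln (K / real M) \<le> 3" using ln8 by (rule order_trans)
      then show ?thesis using True lnK \<open>K > 0\<close> q by simp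
    next
      case False
      have "K powr (1 - s) \<le> (8 * real M) powr (1 - s)"
        using True \<open>K > 0\<close> s by (intro powr_mono2) auto
      also have "\<dots> = 8 powr (1 - s) * real M powr (1 - s)"
        by (simp add: powr_mult)
      also have "\<dots> \<le> 8 powr 1 * real M powr (1 - s)"
        using s by (intro mult_right_mono powr_mono) auto
      finally show ?thesis using False by simp
    qed
    also have "\<dots> \<le> 4 * real M powr (1 - s)" by simp
    finally have "(if s = 1 then ln (q' / real M) else 1) * K powr (1 - s) / 8 - 4 * real M powr (1 - s) \<le> 0"
      by simp
    also have "0 \<le> (\<Sum>n\<in>{M<..N}. real n powr - s)" by (rule sum_nonneg) simp
    finally show ?thesis .
  next
    case False
    then have "K \<ge> 8" using q by linarith
    then have NK: "K / 8 \<le> real N" "K / 4 \<le> real N + 1" unfolding N by linarith+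
    then have "M \<le> N" using False by linarith
    show ?thesis
    proof (cases "s = 1")
      case True
      have "ln (K / real M) - ln 8 = ln ((K / 4) / (2 * real M))"
        using \<open>K > 0\<close> q ln_mult[of 4 "2::real"] by (simp add: ln_div ln_mult)
      also have "\<dots> \<le> ln ((real N + 1) / (real M + 1))"
        using \<open>K > 0\<close> q NK by (intro ln_mono frac_le) auto
      also have "\<dots> \<le> (\<Sum>n\<in>{M<..N}. real n powr - s)"
        using sum_inverse_ge_ln[OF \<open>M \<le> N\<close>] by (simp add: True powr_minus divide_inverse)
      finally have "ln (K / real M) - 3 \<le> (\<Sum>n\<in>{M<..N}. real n powr - s)"
        using ln8 by linarith
      moreover have "0 \<le> ln (K / real M)"
        using \<open>\<not> K < 8 * real M\<close> q by (intro ln_ge_zero) (simp add: field_simps)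
      ultimately have "2 * ln (K / real M) / 8 - 4 \<le> (\<Sum>n\<in>{M<..N}. real n powr - s)"
        by linarith
      then show ?thesis using True lnK \<open>K > 0\<close> q by simp
    next
      case False
      have "K powr (1 - s) / 8 \<le> (K / 8) powr (1 - s)"
      proof -
        have "K powr (1 - s) / 8 powr 1 \<le> K powr (1 - s) / 8 powr (1 - s)"
          using s by (intro divide_left_mono powr_mono) auto
        then show ?thesis using \<open>K > 0\<close> by (simp add: powr_divide)
      qed
      also have "\<dots> \<le> real N powr (1 - s)"
        using NK s \<open>K > 0\<close> by (intro powr_mono2) auto
      \<comment> \<open>Every term with M < n <= N is at least N^{-s}; the M indices left out of the
        block cost at most M^{1-s}.\<close>
      also have "\<dots> = real N powr - s * (real N - real M) + real M * real N powr - s"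
        using q \<open>M \<le> N\<close> by (simp add: powr_diff powr_minus field_simps)
      also have "real M * real N powr - s \<le> real M * real M powr - s"
        using q \<open>M \<le> N\<close> s by (intro mult_left_mono powr_mono2') auto
      also have "\<dots> = real M powr (1 - s)"
        using q by (simp add: powr_diff powr_minus field_simps)
      also have "real N powr - s * (real N - real M) = (\<Sum>n\<in>{M<..N}. real N powr - s)"
        using \<open>M \<le> N\<close> by (simp add: of_nat_diff)
      also have "\<dots> \<le> (\<Sum>n\<in>{M<..N}. real n powr - s)"
        using s by (intro sum_mono powr_mono2') auto
      finally have "K powr (1 - s) / 8 \<le> (\<Sum>n\<in>{M<..N}. real n powr - s) + real M powr (1 - s)"
        by simp
      moreover have "0 \<le> real M powr (1 - s)" by simp
      ultimately show ?thesis using False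
        by (simp only: if_False mult_1)
    qed
  qed
qed

section \<open>Blocks between consecutive denominators\<close>

text \<open>The error sqrt q (1 + ln q) of the unweighted sums times the weight q^{-s} at the start
  of the block.\<close>

definition block_error :: "real \<Rightarrow> real \<Rightarrow> nat \<Rightarrow> real" where
  "block_error s x j = real_of_int (conv_denom x j) powr (1 / 2 - s) * (1 + ln (conv_denom x j))"

text \<open>With K = sqrt (q q') the weight factors as K^{1-s}, the size of the model sum up to K
  with a logarithm at s = 1, times 1/sqrt q, the size of the normalised Gauss sum.\<close>

lemma conv_weight_eq:
  assumes "x \<notin> \<rat>"
  shows "conv_weight s x j = (if s = 1 then ln (conv_denom x (Suc j) / conv_denom x j) else 1)
    * sqrt (real_of_int (conv_denom x j) * conv_denom x (Suc j)) powr (1 - s) / sqrt (conv_denom x j)"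
proof -
  define q q' where "q = real_of_int (conv_denom x j)" and "q' = real_of_int (conv_denom x (Suc j))"
  have pos: "q > 0" "q' > 0"
    unfolding q_def q'_def of_int_0_less_iff by (rule conv_denom_pos[OF assms])+
  have "sqrt (q * q') powr (1 - s) = sqrt ((q * q') powr (1 - s))"
    using pos by (simp add: powr_powr mult.commute flip: powr_half_sqrt)
  also have "(q * q') powr (1 - s) = q * (q' / (q * q') powr s)"
    using pos by (simp add: powr_diff)
  also have "sqrt (q * (q' / (q * q') powr s)) = sqrt q * sqrt (q' / (q * q') powr s)"
    by (rule real_sqrt_mult)
  finally have "sqrt (q * q') powr (1 - s) / sqrt q = sqrt (q' / (q * q') powr s)"
    using pos by simp
  then show ?thesis
    unfolding conv_weight_def delta_wt_def q_def[symmetric] q'_def[symmetric]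
    by (simp only: of_int_mult mult.assoc times_divide_eq_right[symmetric] q_def q'_def)
qed

lemma conv_weight_nonneg:
  assumes "x \<notin> \<rat>"
  shows "conv_weight s x j \<ge> 0"
proof -
  have "1 \<le> real_of_int (conv_denom x (Suc j)) / conv_denom x j"
    using conv_denom_mono[OF assms, of j] conv_denom_pos[OF assms, of j]
    by (simp del: conv_denom.simps)
  then have "0 \<le> ln (real_of_int (conv_denom x (Suc j)) / conv_denom x j)"
    by (rule ln_ge_zero)
  moreover have "0 \<le> sqrt (conv_denom x j)"
    using conv_denom_pos[OF assms, of j] by simp
  ultimately show ?thesis
    unfolding conv_weight_eq[OF assms] by (intro divide_nonneg_nonneg mult_nonneg_nonneg) auto
qed

text \<open>The unweighted error is uniform in the upper endpoint, so summation by parts costs only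
  the first weight, at most (q/4)^{-s} <= 4 q^{-s}; hence 48 = 4 * 12.\<close>

lemma block_approx:
  assumes x: "x \<notin> \<rat>" "j \<ge> 1" and s: "0 < s" "s \<le> 1" and "M \<le> N"
    and MN: "real_of_int (conv_denom x j) \<le> 4 * (real M + 1)" "4 * real N \<le> conv_denom x (Suc j)"
  defines "q \<equiv> conv_denom x j" and "p \<equiv> conv_num x j"
  shows "norm ((F_partial s x N - F_partial s x M)
      - gauss_sum p q 0 / of_int q * weighted_sum s (x - p / q) M N) \<le> 48 * block_error s x j"
proof (cases "M = N")
  case True
  then show ?thesis
    using conv_denom_pos[OF x(1), of j]
    by (simp add: weighted_sum_def block_error_def del: conv_denom.simps)
next
  case False
  then have "M < N" using \<open>M \<le> N\<close> by simp
  define h where "h = x - p / q"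
  have q: "q > 0" unfolding q_def by (rule conv_denom_pos[OF x(1)])
  have q': "conv_denom x (Suc j) > 0" by (rule conv_denom_pos[OF x(1)])
  have qh: "4 * of_int q * \<bar>h\<bar> * real N \<le> 1"
  proof -
    have "4 * of_int q * \<bar>h\<bar> * real N = of_int q * \<bar>h\<bar> * (4 * real N)" by simp
    also have "\<dots> \<le> of_int q * (1 / (of_int q * conv_denom x (Suc j))) * conv_denom x (Suc j)"
      using conv_error_bounds(2)[OF x] MN q q' unfolding h_def p_def q_def
      by (intro mult_mono) (auto simp del: conv_denom.simps)
    also have "\<dots> = 1" using q q' by (simp del: conv_denom.simps)
    finally show ?thesis .
  qed
  have xh: "x = of_int p / of_int q + h" by (simp add: h_def)
  define c where "c = gauss_sum p q 0 / of_int q"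
  define z where "z n = unit_exp (x * real n ^ 2) - c * unit_exp (h * real n ^ 2)" for n :: nat
  define B where "B = 12 * sqrt (of_int q) * (1 + ln (of_int q))"
  have "norm (\<Sum>n\<in>{M<..k}. z n) \<le> B" if "k \<le> N" for k
  proof -
    have "4 * of_int q * \<bar>h\<bar> * real k \<le> 4 * of_int q * \<bar>h\<bar> * real N"
      using that q by (intro mult_left_mono) auto
    then have "4 * of_int q * \<bar>h\<bar> * real k \<le> 1" using qh by linarith
    moreover have "coprime p q" unfolding p_def q_def by (rule coprime_conv)
    ultimately have "norm ((\<Sum>n\<in>{M<..k}. unit_exp (real n ^ 2 * (of_int p / of_int q + h)))
      - gauss_sum p q 0 / of_int q * (\<Sum>n\<in>{M<..k}. unit_exp (h * real n ^ 2))) \<le> B"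
      unfolding B_def using q by (intro quadratic_sum_approx)
    then show ?thesis
      by (simp add: z_def c_def sum_subtractf sum_distrib_left mult.commute flip: xh)
  qed
  then have "norm (\<Sum>n\<in>{M<..N}. (real n powr - s) *\<^sub>R z n) \<le> real (Suc M) powr - s * B"
    using \<open>M < N\<close> s q by (intro sum_mult_abel_bound) (auto simp: B_def intro!: powr_mono2')
  also have "(\<Sum>n\<in>{M<..N}. (real n powr - s) *\<^sub>R z n) = weighted_sum s x M N - c * weighted_sum s h M N"
    by (simp add: z_def weighted_sum_def scaleR_right_diff_distrib sum_subtractf sum_distrib_left)
  also have "weighted_sum s x M N = F_partial s x N - F_partial s x M"
    using \<open>M \<le> N\<close> by (rule F_partial_diff[symmetric])
  also have "real (Suc M) powr - s * B \<le> (4 * of_int q powr - s) * B"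
  proof (rule mult_right_mono)
    have "real (Suc M) powr - s \<le> (of_int q / 4) powr - s"
      using MN q s by (intro powr_mono2') (auto simp: q_def)
    also have "\<dots> = of_int q powr - s * 4 powr s"
      by (simp add: powr_divide powr_minus_divide)
    also have "\<dots> \<le> of_int q powr - s * 4 powr 1"
      using s by (intro mult_left_mono powr_mono) auto
    finally show "real (Suc M) powr - s \<le> 4 * of_int q powr - s" by simp
  qed (use q in \<open>simp add: B_def\<close>)
  also have "\<dots> = 48 * ((of_int q powr - s * sqrt (of_int q)) * (1 + ln (of_int q)))"
    by (simp add: B_def)
  also have "of_int q powr - s * sqrt (of_int q) = of_int q powr (1 / 2 - s)"
    using q by (simp flip: powr_half_sqrt powr_add)
  also have "48 * (of_int q powr (1 / 2 - s) * (1 + ln (of_int q))) = 48 * block_error s x j"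
    by (simp add: block_error_def q_def)
  finally show ?thesis by (simp add: c_def h_def)
qed

lemma block_error_ge:
  assumes "x \<notin> \<rat>" "s \<le> 1"
  shows "1 / sqrt (conv_denom x j) \<le> block_error s x j"
    and "real_of_int (conv_denom x j) powr (1 - s) / sqrt (conv_denom x j) \<le> block_error s x j"
proof -
  define q where "q = real_of_int (conv_denom x j)"
  have q: "q \<ge> 1" using conv_denom_pos[OF assms(1), of j] by (simp add: q_def del: conv_denom.simps)
  have "q powr (1 / 2 - s) \<le> block_error s x j"
    using q mult_left_mono[of 1 "1 + ln q" "q powr (1 / 2 - s)"] by (simp add: block_error_def flip: q_def)
  moreover have "q powr (1 - s) / sqrt q = q powr (1 / 2 - s)"
  proof -
    have "q powr (1 - s) / q powr (1 / 2) = q powr (1 - s - 1 / 2)" by (rule powr_diff[symmetric])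
    then show ?thesis using q by (simp add: powr_half_sqrt)
  qed
  moreover have "1 / sqrt q \<le> q powr (1 - s) / sqrt q"
    using q assms(2) by (intro divide_right_mono ge_one_powr_ge_zero) auto
  ultimately show "1 / sqrt (conv_denom x j) \<le> block_error s x j"
     "real_of_int (conv_denom x j) powr (1 - s) / sqrt (conv_denom x j) \<le> block_error s x j"
    unfolding q_def by linarith+
qed

text \<open>For inadmissible j the Gauss sum kills the main term. Otherwise its normalised modulus
  is at most 2/sqrt q, and the stray +1 of the model estimate becomes 1/sqrt q, which the error
  absorbs. The constant is 48 + 2 (7 + 1/(1 - s)).\<close>

lemma block_upper_bound:
  assumes x: "x \<notin> \<rat>" "j \<ge> 1" and s: "0 < s" "s \<le> 1" and "M \<le> N"
    and MN: "real_of_int (conv_denom x j) \<le> 4 * (real M + 1)" "4 * real N \<le> conv_denom x (Suc j)"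
  shows "norm (F_partial s x N - F_partial s x M)
    \<le> (62 + 2 / (1 - s)) * ((if j \<in> adm_indices x then conv_weight s x j else 0) + block_error s x j)"
proof -
  define q p where "q = conv_denom x j" and "p = conv_num x j"
  define C where "C = 7 + 1 / (1 - s)"
  define G where "G = gauss_sum p q 0 / of_int q * weighted_sum s (x - p / q) M N"
  have "C \<ge> 7" using s by (simp add: C_def)
  have q: "q > 0" unfolding q_def by (rule conv_denom_pos[OF x(1)])
  have q': "conv_denom x (Suc j) > 0" by (rule conv_denom_pos[OF x(1)])
  have cop: "coprime p q" unfolding p_def q_def by (rule coprime_conv)
  have approx: "norm ((F_partial s x N - F_partial s x M) - G) \<le> 48 * block_error s x j"
    unfolding G_def p_def q_def using assms by (intro block_approx) auto
  have err: "1 / sqrt q \<le> block_error s x j"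
    unfolding q_def using x s by (intro block_error_ge)
  then have err0: "block_error s x j \<ge> 0" using q by (simp add: order_trans[OF _ err])
  have "norm G \<le> 2 * C * ((if j \<in> adm_indices x then conv_weight s x j else 0) + block_error s x j)"
  proof (cases "j \<in> adm_indices x")
    case False
    then have "twice_odd q" using x(2) by (simp add: adm_indices_def q_def)
    then have "G = 0" using gauss_sum_twice_odd[OF q cop] by (simp add: G_def)
    then show ?thesis using \<open>C \<ge> 7\<close> err0 False by simp
  next
    case True
    define K where "K = sqrt (real_of_int q * conv_denom x (Suc j))"
    define \<delta> where "\<delta> = (if s = 1 then ln (conv_denom x (Suc j) / real_of_int q) else 1)"
    have "4 * \<bar>x - p / q\<bar> * real N \<le> 1"
    proof -
      have "\<bar>x - p / q\<bar> * (4 * real N) \<le> (1 / (of_int q * conv_denom x (Suc j))) * conv_denom x (Suc j)"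
        using conv_error_bounds(2)[OF x] MN q q' unfolding p_def q_def
        by (intro mult_mono) (auto simp del: conv_denom.simps)
      also have "\<dots> = 1 / q" using q' by (simp del: conv_denom.simps)
      also have "\<dots> \<le> 1" using q by simp
      finally show ?thesis by simp
    qed
    then have W: "norm (weighted_sum s (x - p / q) M N) \<le> C * (\<delta> * K powr (1 - s) + 1)"
      unfolding C_def \<delta>_def using s q conv_denom_mono[OF x(1), of j] conv_error_bounds(1)[OF x] MN \<open>M \<le> N\<close>
      by (intro weighted_sum_le[OF _ _ _ _ K_def]) (auto simp: q_def p_def simp del: conv_denom.simps)
    have "norm (gauss_sum p q 0 / of_int q) \<le> 2 / sqrt q"
    proof -
      have "sqrt (2 * of_int q) \<le> sqrt (4 * of_int q)" using q by simp
      then have "norm (gauss_sum p q 0) \<le> 2 * sqrt q"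
        using norm_gauss_sum_le[OF q cop, of 0] by (simp add: real_sqrt_mult)
      then have "norm (gauss_sum p q 0) / q \<le> 2 * sqrt q / q"
        using q by (intro divide_right_mono) auto
      also have "\<dots> = 2 / sqrt q"
        using q real_div_sqrt[of "of_int q"] by (simp add: field_simps)
      finally show ?thesis using q by (simp add: norm_divide)
    qed
    then have "norm G \<le> 2 / sqrt q * (C * (\<delta> * K powr (1 - s) + 1))"
      unfolding G_def norm_mult using W q by (intro mult_mono) auto
    also have "\<dots> = 2 * C * (\<delta> * K powr (1 - s) / sqrt q + 1 / sqrt q)"
      by (simp add: distrib_left add_divide_distrib)
    also have "\<delta> * K powr (1 - s) / sqrt q = conv_weight s x j"
      unfolding conv_weight_eq[OF x(1)] \<delta>_def K_def q_def by simp
    also have "2 * C * (conv_weight s x j + 1 / sqrt q) \<le> 2 * C * (conv_weight s x j + block_error s x j)"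
      using err \<open>C \<ge> 7\<close> by (intro mult_left_mono add_left_mono) auto
    finally show ?thesis using True by simp
  qed
  then have "norm (F_partial s x N - F_partial s x M) \<le> 48 * block_error s x j
      + 2 * C * ((if j \<in> adm_indices x then conv_weight s x j else 0) + block_error s x j)"
    using approx norm_triangle_sub[of "F_partial s x N - F_partial s x M" G] by linarith
  also have "\<dots> \<le> 48 * ((if j \<in> adm_indices x then conv_weight s x j else 0) + block_error s x j)
      + 2 * C * ((if j \<in> adm_indices x then conv_weight s x j else 0) + block_error s x j)"
    using conv_weight_nonneg[OF x(1), of s j] by simp
  also have "\<dots> = (62 + 2 / (1 - s)) * ((if j \<in> adm_indices x then conv_weight s x j else 0) + block_error s x j)"
    by (simp add: C_def distrib_right)
  finally show ?thesis .
qed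

text \<open>The witness is a quarter of sqrt (q_j q_{j+1}), rounded down: up to there the model
  phase does not oscillate and the Gauss sum has modulus at least sqrt q_j. Since the starting point
  q_j tends to infinity with j, the bound can be played against the Cauchy criterion.\<close>

lemma block_lower_bound:
  assumes x: "x \<notin> \<rat>" and j: "j \<in> adm_indices x" and s: "0 < s" "s \<le> 1"
  shows "\<exists>N \<ge> nat (conv_denom x j). conv_weight s x j
    \<le> 16 * norm (F_partial s x N - F_partial s x (nat (conv_denom x j))) + 1000 * block_error s x j"
proof -
  have j1: "j \<ge> 1" "\<not> twice_odd (conv_denom x j)" using j by (auto simp: adm_indices_def)
  define q p where "q = conv_denom x j" and "p = conv_num x j"
  define q' where "q' = real_of_int (conv_denom x (Suc j))"
  define M where "M = nat q"
  define K where "K = sqrt (real M * q')"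
  define N where "N = nat \<lfloor>K / 4\<rfloor>"
  define S where "S = (\<Sum>n\<in>{M<..N}. real n powr - s)"
  have q: "q > 0" unfolding q_def by (rule conv_denom_pos[OF x(1)])
  have M: "real M = of_int q" "M \<ge> 1" using q by (auto simp: M_def)
  have q': "real M \<le> q'" unfolding q'_def M(1) q_def of_int_le_iff by (rule conv_denom_mono[OF x])
  have cop: "coprime p q" unfolding p_def q_def by (rule coprime_conv)
  have err: "real_of_int q powr (1 - s) / sqrt q \<le> block_error s x j"
    unfolding q_def using x s by (intro block_error_ge)
  then have err0: "block_error s x j \<ge> 0" using q by (simp add: order_trans[OF _ err])
  have "0 < K" using M q' by (simp add: K_def)
  have "conv_weight s x j / 8 - 4 * (real_of_int q powr (1 - s) / sqrt q)
      = ((if s = 1 then ln (q' / real M) else 1) * K powr (1 - s) / 8 - 4 * real M powr (1 - s)) / sqrt q"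
    unfolding conv_weight_eq[OF x] K_def M(1) q'_def q_def by (simp add: diff_divide_distrib)
  also have "\<dots> \<le> S / sqrt q"
    unfolding S_def using s M q' q by (intro divide_right_mono sum_powr_ge[OF _ _ _ _ K_def N_def]) auto
  finally have S: "conv_weight s x j / 8 - 4 * block_error s x j \<le> S / sqrt q"
    using err by linarith
  show ?thesis
  proof (cases "M \<le> N")
    \<comment> \<open>The stretch is empty, so the weight is itself dominated by the error and the
      trivial witness q_j suffices.\<close>
    case False
    then have "S = 0" by (simp add: S_def)
    then have "conv_weight s x j \<le> 1000 * block_error s x j" using S err0 by simp
    then show ?thesis by (intro exI[of _ "nat (conv_denom x j)"]) simp
  next
    case True
    have "real N \<le> K / 4" unfolding N_def using \<open>0 < K\<close> by (intro of_nat_floor) simp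
    have "K \<le> q'"
      unfolding K_def using q' M(2) by (intro real_le_lsqrt) (auto simp: power2_eq_square)
    define h where "h = x - p / q"
    define G where "G = gauss_sum p q 0 / of_int q * weighted_sum s h M N"
    have "norm ((F_partial s x N - F_partial s x M) - G) \<le> 48 * block_error s x j"
      unfolding G_def h_def p_def q_def using x j1 s True \<open>real N \<le> K / 4\<close> \<open>K \<le> q'\<close> M
      by (intro block_approx) (auto simp: q_def q'_def simp del: conv_denom.simps)
    then have "norm G \<le> norm (F_partial s x N - F_partial s x M) + 48 * block_error s x j"
      using norm_triangle_sub[of G "F_partial s x N - F_partial s x M"] by (simp add: norm_minus_commute)
    moreover have "S / sqrt q / 2 \<le> norm G"
    proof -
      have "0 \<le> real_of_int (conv_denom x j) * conv_denom x (Suc j)"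
        using M q' by (simp add: q_def q'_def del: conv_denom.simps)
      then have "\<bar>h\<bar> * real N ^ 2 \<le> 1 / (real M * q') * (K / 4) ^ 2"
        using conv_error_bounds(2)[OF x j1(1)] \<open>real N \<le> K / 4\<close> \<open>0 < K\<close> M(1)
        by (intro mult_mono power_mono) (auto simp: h_def p_def q_def q'_def simp del: conv_denom.simps)
      also have "\<dots> = 1 / 16"
        using M q' by (simp add: K_def power_divide)
      finally have W: "S / 2 \<le> norm (weighted_sum s h M N)"
        unfolding S_def by (rule norm_weighted_sum_ge)
      have "sqrt q / q \<le> norm (gauss_sum p q 0 / of_int q)"
        using norm_gauss_sum_ge[OF q cop] j1 q by (simp add: norm_divide divide_right_mono q_def)
      moreover have "sqrt q / q = 1 / sqrt q"
        using q real_div_sqrt[of "of_int q"] by (simp add: field_simps)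
      ultimately have "1 / sqrt q * (S / 2) \<le> norm G"
        unfolding G_def norm_mult using W q by (intro mult_mono) (auto simp: S_def intro: sum_nonneg)
      then show ?thesis by simp
    qed
    \<comment> \<open>Write w for the weight, E for the error and D for the norm of the difference
      of partial sums. Then w/16 - 2 E <= norm G <= D + 48 E, so 800 E would do; 1000 is a round
      value.\<close>
    ultimately have "conv_weight s x j \<le> 16 * norm (F_partial s x N - F_partial s x M) + 1000 * block_error s x j"
      using S err0 by argo
    then show ?thesis using True by (auto simp: M_def q_def)
  qed
qed

section \<open>Convergence and the approximation exponent\<close>

text \<open>Cauchy criterion over blocks: controlling every intermediate N, not only the block ends,
  passes from convergence along \<open>m\<close> to convergence of the whole sequence.\<close>

lemma convergent_by_blocks:
  fixes P :: "nat \<Rightarrow> 'a :: banach"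
  assumes m: "\<And>j. m j \<le> m (Suc j)" "filterlim m at_top sequentially"
    and T: "summable T"
    and block: "\<And>j N. 1 \<le> j \<Longrightarrow> m j \<le> N \<Longrightarrow> N \<le> m (Suc j) \<Longrightarrow> norm (P N - P (m j)) \<le> T j"
  shows "convergent P"
proof -
  have T0: "T j \<ge> 0" if "1 \<le> j" for j
    using block[OF that, of "m j"] m(1)[of j] by simp
  have telescope: "norm (P N - P (m J)) \<le> sum T {J..<J + k}" if "1 \<le> J" "m J \<le> N" "N \<le> m (J + k)" for J k N
    using that(2,3)
  proof (induction k arbitrary: N)
    case (Suc k)
    show ?case
    proof (cases "N \<le> m (J + k)")
      case True
      then show ?thesis using Suc T0[of "J + k"] that(1) by force
    next
      case False
      have "m J \<le> m (J + k)" using lift_Suc_mono_le[of m, OF m(1)] by simp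
      then have "norm (P (m (J + k)) - P (m J)) \<le> sum T {J..<J + k}" by (rule Suc.IH) simp
      moreover have "norm (P N - P (m (J + k))) \<le> T (J + k)"
        using False Suc that(1) by (intro block) auto
      ultimately show ?thesis
        using norm_triangle_ineq[of "P N - P (m (J + k))" "P (m (J + k)) - P (m J)"] by simp
    qed
  qed simp
  have "Cauchy P"
  proof (rule metric_CauchyI)
    fix e :: real assume "e > 0"
    then obtain J where J: "\<And>i n. J \<le> i \<Longrightarrow> norm (sum T {i..<n}) < e / 2"
      using T unfolding summable_Cauchy by (metis half_gt_zero)
    define I where "I = max 1 J"
    have close: "norm (P N - P (m I)) < e / 2" if "m I \<le> N" for N
    proof -
      obtain k where k: "\<And>i. k \<le> i \<Longrightarrow> N \<le> m i"
        using m(2) unfolding filterlim_at_top eventually_sequentially by blast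
      have "norm (P N - P (m I)) \<le> sum T {I..<I + k}"
        using that by (intro telescope k) (auto simp: I_def)
      also have "\<dots> \<le> norm (sum T {I..<I + k})" by simp
      also have "\<dots> < e / 2" by (rule J) (simp add: I_def)
      finally show ?thesis .
    qed
    show "\<exists>M. \<forall>a\<ge>M. \<forall>b\<ge>M. dist (P a) (P b) < e"
    proof (intro exI allI impI)
      fix a b assume "m I \<le> a" "m I \<le> b"
      then show "dist (P a) (P b) < e"
        using close[of a] close[of b] dist_triangle_half_l[of "P a" "P (m I)" e "P b"]
        by (simp add: dist_norm)
    qed
  qed
  then show ?thesis by (rule Cauchy_convergent)
qed

text \<open>Half of the exponent absorbs the logarithm, since ln q <= (2/\<epsilon>)
  q^{\<epsilon>/2}. The factor c is 1 for the block errors and a bound \<rho> on the exponents for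
  the weights.\<close>

lemma summable_conv_denom_powr_ln:
  assumes x: "x \<notin> \<rat>" and "\<epsilon> > 0" "c \<ge> 0"
  shows "summable (\<lambda>j. real_of_int (conv_denom x j) powr (- \<epsilon>) * (1 + c * ln (conv_denom x j)))"
proof (rule summable_comparison_test')
  show "summable (\<lambda>j. (1 + 2 * c / \<epsilon>) * real_of_int (conv_denom x j) powr (- (\<epsilon> / 2)))"
    using assms by (intro summable_mult summable_conv_denom_powr) auto
  fix j :: nat
  define q where "q = real_of_int (conv_denom x j)"
  have q: "q \<ge> 1" using conv_denom_pos[OF x, of j] by (simp add: q_def del: conv_denom.simps)
  have "c * ln q \<le> c * (q powr (\<epsilon> / 2) / (\<epsilon> / 2))"
    using assms q by (intro mult_left_mono ln_powr_bound) auto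
  moreover have "1 \<le> q powr (\<epsilon> / 2)"
    using assms q by (intro ge_one_powr_ge_zero) auto
  ultimately have "1 + c * ln q \<le> (1 + 2 * c / \<epsilon>) * q powr (\<epsilon> / 2)"
    by (simp add: field_simps)
  then have "q powr (- \<epsilon>) * (1 + c * ln q) \<le> q powr (- \<epsilon>) * ((1 + 2 * c / \<epsilon>) * q powr (\<epsilon> / 2))"
    by (rule mult_left_mono) simp
  also have "\<dots> = (1 + 2 * c / \<epsilon>) * q powr (- (\<epsilon> / 2))"
    by (simp add: mult.left_commute flip: powr_add)
  finally show "norm (real_of_int (conv_denom x j) powr (- \<epsilon>) * (1 + c * ln (conv_denom x j)))
      \<le> (1 + 2 * c / \<epsilon>) * real_of_int (conv_denom x j) powr (- (\<epsilon> / 2))"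
    using q assms unfolding q_def[symmetric] by (simp add: abs_mult)
qed

lemma summable_block_error:
  assumes "x \<notin> \<rat>" "1 / 2 < s"
  shows "summable (block_error s x)"
  using summable_conv_denom_powr_ln[OF assms(1), of "s - 1 / 2" 1] assms(2)
  by (simp add: block_error_def[abs_def])

lemma convergent_F_partial_if_summable:
  assumes x: "x \<notin> \<rat>" and s: "1 / 2 < s" "s \<le> 1"
    and weights: "summable (\<lambda>j. if j \<in> adm_indices x then conv_weight s x j else 0)"
  shows "convergent (F_partial s x)"
proof (rule convergent_by_blocks)
  \<comment> \<open>Rounding q_j/4 down satisfies both endpoint conditions of the block estimate, so
    consecutive blocks share their endpoints.\<close>
  define m where "m j = nat (conv_denom x j div 4)" for j
  define T where "T j = (62 + 2 / (1 - s)) *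
    ((if j \<in> adm_indices x then conv_weight s x j else 0) + block_error s x j)" for j
  show "m j \<le> m (Suc j)" for j
    unfolding m_def by (intro nat_mono zdiv_mono1 conv_denom_mono x) simp
  have m_bounds: "real_of_int (conv_denom x j) \<le> 4 * (real (m j) + 1)" "4 * real (m j) \<le> conv_denom x j" for j
  proof -
    have "int (m j) = conv_denom x j div 4"
      using conv_denom_pos[OF x, of j] by (simp add: m_def)
    then have "conv_denom x j \<le> 4 * (int (m j) + 1)" "4 * int (m j) \<le> conv_denom x j"
      by presburger+
    then have "real_of_int (conv_denom x j) \<le> of_int (4 * (int (m j) + 1))"
      "real_of_int (4 * int (m j)) \<le> conv_denom x j"
      by (simp_all only: of_int_le_iff)
    then show "real_of_int (conv_denom x j) \<le> 4 * (real (m j) + 1)" "4 * real (m j) \<le> conv_denom x j"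
      by simp_all
  qed
  show "filterlim m at_top sequentially"
    unfolding filterlim_at_top
  proof
    fix Z :: nat
    have "\<forall>\<^sub>F j in sequentially. 4 * real Z + 4 \<le> conv_denom x j"
      using conv_denom_at_top[OF x] unfolding filterlim_at_top by blast
    then show "\<forall>\<^sub>F j in sequentially. Z \<le> m j"
    proof eventually_elim
      case (elim j)
      then have "4 * real Z \<le> 4 * real (m j)" using m_bounds(1)[of j] by argo
      then show ?case by simp
    qed
  qed
  show "summable T"
    unfolding T_def using weights summable_block_error[OF x s(1)] by (intro summable_mult summable_add)
  show "norm (F_partial s x N - F_partial s x (m j)) \<le> T j" if "1 \<le> j" "m j \<le> N" "N \<le> m (Suc j)" for j N
    unfolding T_def
  proof (rule block_upper_bound)
    have "4 * real N \<le> 4 * real (m (Suc j))" using that(3) by simp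
    also have "\<dots> \<le> conv_denom x (Suc j)" by (rule m_bounds)
    finally show "4 * real N \<le> conv_denom x (Suc j)" .
  qed (use x s that m_bounds in auto)
qed

lemma conv_weight_small_if_convergent:
  assumes x: "x \<notin> \<rat>" and s: "1 / 2 < s" "s \<le> 1" and "convergent (F_partial s x)" "\<eta> > 0"
  shows "\<forall>\<^sub>F j in inf sequentially (principal (adm_indices x)). conv_weight s x j < \<eta>"
proof -
  have "Cauchy (F_partial s x)" using assms(4) by (rule convergent_Cauchy)
  \<comment> \<open>Budget: 16 * (\<eta>/64) + 1000 * (\<eta>/4000) = \<eta>/2.\<close>
  then obtain Z where Z: "\<And>a b. Z \<le> a \<Longrightarrow> Z \<le> b \<Longrightarrow> norm (F_partial s x a - F_partial s x b) < \<eta> / 64"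
    using \<open>\<eta> > 0\<close> unfolding Cauchy_def dist_norm by (metis divide_pos_pos zero_less_numeral)
  have "\<forall>\<^sub>F j in sequentially. real Z + 1 \<le> conv_denom x j"
    using conv_denom_at_top[OF x] unfolding filterlim_at_top by blast
  moreover have "\<forall>\<^sub>F j in sequentially. block_error s x j < \<eta> / 4000"
    using summable_LIMSEQ_zero[OF summable_block_error[OF x s(1)]] \<open>\<eta> > 0\<close>
    by (intro order_tendstoD(2)) auto
  ultimately show ?thesis
    unfolding eventually_inf_principal
  proof eventually_elim
    case (elim j)
    show ?case
    proof
      assume "j \<in> adm_indices x"
      then obtain N where N: "nat (conv_denom x j) \<le> N" "conv_weight s x j
          \<le> 16 * norm (F_partial s x N - F_partial s x (nat (conv_denom x j))) + 1000 * block_error s x j"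
        using block_lower_bound[OF x, of j s] s by auto
      moreover have "Z \<le> nat (conv_denom x j)" using elim(1) by linarith
      ultimately show "conv_weight s x j < \<eta>"
        using Z[of N "nat (conv_denom x j)"] elim(2) \<open>\<eta> > 0\<close> by linarith
    qed
  qed
qed

section \<open>Comparison of the weights with the approximation exponents\<close>

lemma eventually_adm_indices:
  "\<forall>\<^sub>F j in inf sequentially (principal (adm_indices x)). j \<in> adm_indices x"
  by (simp add: eventually_inf_principal)

lemma eventually_conv_denom_ge_2:
  assumes "x \<notin> \<rat>"
  shows "\<forall>\<^sub>F j in inf sequentially (principal (adm_indices x)). 2 \<le> conv_denom x j"
proof -
  have "\<forall>\<^sub>F j in sequentially. 2 \<le> real_of_int (conv_denom x j)"
    using conv_denom_at_top[OF assms] unfolding filterlim_at_top by blast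
  then show ?thesis
    unfolding eventually_inf_principal by eventually_elim simp
qed

lemma adm_filter_neq_bot:
  assumes "x \<notin> \<rat>"
  shows "inf sequentially (principal (adm_indices x)) \<noteq> bot"
  unfolding trivial_limit_def eventually_inf_principal eventually_sequentially
  using infinite_adm_indices[OF assms] by auto

text \<open>By definition q_j^{r_j} is the inverse of the approximation error, which is known up to
  a factor 2. This is the dictionary between exponents and weights.\<close>

lemma conv_denom_product_bounds:
  assumes x: "x \<notin> \<rat>" and j: "j \<ge> 1" "conv_denom x j \<ge> 2"
  shows "real_of_int (conv_denom x j) * conv_denom x (Suc j) \<le> real_of_int (conv_denom x j) powr approx_exponent x j"
    and "real_of_int (conv_denom x j) powr approx_exponent x j \<le> 2 * (real_of_int (conv_denom x j) * conv_denom x (Suc j))"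
proof -
  define Q where "Q = real_of_int (conv_denom x j) * conv_denom x (Suc j)"
  define w where "w = real_of_int (conv_denom x j) powr approx_exponent x j"
  have "Q > 0" using conv_denom_pos[OF x, of j] conv_denom_pos[OF x, of "Suc j"]
    by (simp add: Q_def del: conv_denom.simps)
  moreover have "w > 0" using j by (simp add: w_def)
  moreover have "1 / (2 * Q) \<le> 1 / w" "1 / w \<le> 1 / Q"
    using conv_error_bounds[OF x j(1)] unfolding approx_exponent_powr[OF x j(2)] powr_minus_divide Q_def w_def
    by auto
  ultimately show "Q \<le> w" "w \<le> 2 * Q"
    by (simp_all add: field_simps)
qed

lemma approx_exponent_ge_2:
  assumes x: "x \<notin> \<rat>" and j: "j \<ge> 1" "conv_denom x j \<ge> 2"
  shows "approx_exponent x j \<ge> 2"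
proof -
  define q where "q = real_of_int (conv_denom x j)"
  have q: "q \<ge> 2" using j by (simp add: q_def)
  have "q powr 2 = q * q" using q by (simp add: power2_eq_square)
  also have "\<dots> \<le> q * conv_denom x (Suc j)"
    using conv_denom_mono[OF x, of j] q unfolding q_def by (intro mult_left_mono) (auto simp del: conv_denom.simps)
  also have "\<dots> \<le> q powr approx_exponent x j"
    unfolding q_def by (rule conv_denom_product_bounds[OF x j])
  finally show ?thesis
    using powr_le_cancel_iff[of q 2 "approx_exponent x j"] q by simp
qed

text \<open>Excludes minus infinity and small values, so that the reciprocal in the extended reals
  reduces to an ordinary one or to 0.\<close>

lemma r_odd_ge_2:
  assumes "x \<notin> \<rat>"
  shows "r_odd x \<ge> 2"
  unfolding r_odd_def
proof (rule le_Limsup[OF adm_filter_neq_bot[OF assms]])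
  show "\<forall>\<^sub>F j in inf sequentially (principal (adm_indices x)). 2 \<le> ereal (approx_exponent x j)"
    using eventually_adm_indices[of x] eventually_conv_denom_ge_2[OF assms]
  proof eventually_elim
    case (elim j)
    then have "2 \<le> approx_exponent x j"
      by (intro approx_exponent_ge_2[OF assms]) (auto simp: adm_indices_def)
    then show ?case by (metis ereal_less_eq(3) numeral_eq_ereal)
  qed
qed

text \<open>The hypothesis amounts to r (1 - s) < 1 for a finite limit superior r; an infinite one
  would force s > 1. For \<rho> slightly above r, eventually q q' <= q^\<rho>, which bounds the
  weight by a negative power of q times a logarithm.\<close>

lemma summable_conv_weight:
  assumes x: "x \<notin> \<rat>" and s: "1 / 2 < s" "s \<le> 1"
    and H: "(ereal (s - 1) + 1 / r_odd x) / 2 > 0"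
  shows "summable (\<lambda>j. if j \<in> adm_indices x then conv_weight s x j else 0)"
proof -
  obtain r where r: "r_odd x = ereal r" "r \<ge> 2" "r * (1 - s) < 1"
  proof (cases "r_odd x")
    case (real r)
    then have "r \<ge> 2" using r_odd_ge_2[OF x] by (metis ereal_less_eq(3) numeral_eq_ereal)
    then have "1 / r_odd x = ereal (1 / r)" using real by (simp add: one_ereal_def)
    then have "(s - 1 + 1 / r) / 2 > 0" using H by (simp add: zero_ereal_def add: numeral_eq_ereal)
    then have "r * (1 - s) < 1" using \<open>r \<ge> 2\<close> by (simp add: field_simps)
    then show ?thesis using that real \<open>r \<ge> 2\<close> by blast
  next
    case PInf
    then show ?thesis using H s by (simp add: zero_ereal_def add: numeral_eq_ereal)
  next
    case MInf
    then show ?thesis using r_odd_ge_2[OF x] by simp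
  qed
  \<comment> \<open>A value above r with \<rho> (1 - s) < 1, written without dividing by 1 - s,
    which may be 0; it works because 1 - s < 1.\<close>
  define \<rho> where "\<rho> = r + (1 - r * (1 - s))"
  have "\<rho> > r" "\<rho> \<ge> 0" using r by (auto simp: \<rho>_def)
  have \<rho>: "\<rho> * (1 - s) < 1"
  proof -
    have "(1 - r * (1 - s)) * (1 - s) < (1 - r * (1 - s)) * 1"
      using r s by (intro mult_strict_left_mono) auto
    then show ?thesis by (simp add: \<rho>_def distrib_right)
  qed
  define \<epsilon> where "\<epsilon> = (1 - \<rho> * (1 - s)) / 2"
  have "\<epsilon> > 0" using \<rho> by (simp add: \<epsilon>_def)
  have "Limsup (inf sequentially (principal (adm_indices x))) (\<lambda>j. ereal (approx_exponent x j)) < ereal \<rho>"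
    using r(1) \<open>\<rho> > r\<close> by (simp add: r_odd_def)
  then have "\<forall>\<^sub>F j in inf sequentially (principal (adm_indices x)). ereal (approx_exponent x j) < ereal \<rho>"
    by (rule Limsup_lessD)
  then have "\<forall>\<^sub>F j in inf sequentially (principal (adm_indices x)).
      conv_weight s x j \<le> real_of_int (conv_denom x j) powr (- \<epsilon>) * (1 + \<rho> * ln (conv_denom x j))"
    using eventually_conv_denom_ge_2[OF x] eventually_adm_indices[of x]
  proof eventually_elim
    case (elim j)
    define q q' where "q = real_of_int (conv_denom x j)" and "q' = real_of_int (conv_denom x (Suc j))"
    have j: "j \<ge> 1" using elim by (simp add: adm_indices_def)
    have q: "q \<ge> 2" using elim by (simp add: q_def)
    have q': "q' \<ge> q" using conv_denom_mono[OF x, of j] unfolding q_def q'_def of_int_le_iff .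
    have "q * q' \<le> q powr approx_exponent x j"
      unfolding q_def q'_def using elim by (intro conv_denom_product_bounds[OF x j])
    also have "\<dots> \<le> q powr \<rho>"
      using elim q by (intro powr_mono) auto
    finally have Q: "q * q' \<le> q powr \<rho>" .
    have "sqrt (q * q') powr (1 - s) = (q * q') powr ((1 - s) / 2)"
      using q q' by (simp add: powr_powr flip: powr_half_sqrt)
    also have "\<dots> \<le> (q powr \<rho>) powr ((1 - s) / 2)"
      using Q q q' s by (intro powr_mono2) auto
    also have "\<dots> = q powr (\<rho> * (1 - s) / 2)" by (simp add: powr_powr)
    finally have "sqrt (q * q') powr (1 - s) / sqrt q \<le> q powr (\<rho> * (1 - s) / 2) / q powr (1 / 2)"
      using q by (simp add: powr_half_sqrt divide_right_mono)
    also have "\<dots> = q powr (- \<epsilon>)"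
      by (simp add: \<epsilon>_def diff_divide_distrib flip: powr_diff)
    finally have base: "sqrt (q * q') powr (1 - s) / sqrt q \<le> q powr (- \<epsilon>)" .
    \<comment> \<open>The summand 1 serves s < 1 and the logarithm serves s = 1, where q'/q <= q q'
      <= q^\<rho>.\<close>
    have "(if s = 1 then ln (q' / q) else 1) \<le> 1 + \<rho> * ln q"
    proof -
      have "q' / q \<le> q * q'" using q q' mult_mono[of 1 q 1 q] by (simp add: field_simps mult_mono)
      then have "ln (q' / q) \<le> ln (q powr \<rho>)" using Q q q' by (intro ln_mono) auto
      also have "\<dots> = \<rho> * ln q" using q by (simp add: ln_powr)
      finally show ?thesis using q \<open>\<rho> \<ge> 0\<close> by simp
    qed
    then have "(if s = 1 then ln (q' / q) else 1) * (sqrt (q * q') powr (1 - s) / sqrt q) \<le> (1 + \<rho> * ln q) * q powr (- \<epsilon>)"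
      using base q \<open>\<rho> \<ge> 0\<close> by (intro mult_mono) auto
    then show ?case
      unfolding conv_weight_eq[OF x] q_def q'_def by (simp only: mult.commute times_divide_eq_right)
  qed
  then have "\<forall>\<^sub>F j in sequentially. norm (if j \<in> adm_indices x then conv_weight s x j else 0)
      \<le> real_of_int (conv_denom x j) powr (- \<epsilon>) * (1 + \<rho> * ln (conv_denom x j))"
    unfolding eventually_inf_principal
  proof eventually_elim
    case (elim j)
    have "conv_denom x j \<ge> 1" using conv_denom_pos[OF x, of j] by simp
    then show ?case using elim conv_weight_nonneg[OF x, of s j] \<open>\<rho> \<ge> 0\<close> by simp
  qed
  then show ?thesis
    using summable_conv_denom_powr_ln[OF x \<open>\<epsilon> > 0\<close> \<open>\<rho> \<ge> 0\<close>] by (rule summable_comparison_test_ev)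
qed

text \<open>By contradiction: weights eventually below 1/2 force r_j <= 1/(1 - s) eventually,
  against the hypothesis on the limit superior. An exponent above 1/(1 - s) gives sqrt q <= 2
  K^{1-s} with K = sqrt (q q'), which is where the threshold 1/2 comes from.\<close>

lemma Limsup_conv_weight_pos:
  assumes x: "x \<notin> \<rat>" and s: "1 / 2 < s" "s \<le> 1"
    and H: "(ereal (s - 1) + 1 / r_odd x) / 2 < 0"
  shows "Limsup (inf sequentially (principal (adm_indices x))) (\<lambda>j. ereal (conv_weight s x j)) > 0"
proof (rule ccontr)
  assume "\<not> ?thesis"
  then have "Limsup (inf sequentially (principal (adm_indices x))) (\<lambda>j. ereal (conv_weight s x j)) < ereal (1 / 2)"
    by (auto simp: not_less elim: le_less_trans)
  then have small: "\<forall>\<^sub>F j in inf sequentially (principal (adm_indices x)). ereal (conv_weight s x j) < ereal (1 / 2)"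
    by (rule Limsup_lessD)
  have "s < 1 \<and> ereal (1 / (1 - s)) < r_odd x"
  proof (cases "r_odd x")
    case (real r)
    then have "r \<ge> 2" using r_odd_ge_2[OF x] by (metis ereal_less_eq(3) numeral_eq_ereal)
    then have "1 / r_odd x = ereal (1 / r)" using real by (simp add: one_ereal_def)
    then have *: "s - 1 + 1 / r < 0" using H by (simp add: zero_ereal_def add: numeral_eq_ereal)
    moreover have "1 / r > 0" using \<open>r \<ge> 2\<close> by simp
    ultimately have "s < 1" by linarith
    moreover have "1 / (1 - s) < r" using * \<open>r \<ge> 2\<close> \<open>s < 1\<close> by (simp add: field_simps)
    ultimately show ?thesis using real by simp
  next
    case PInf
    then show ?thesis using H s by (simp add: zero_ereal_def add: numeral_eq_ereal)
  next
    case MInf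
    then show ?thesis using r_odd_ge_2[OF x] by simp
  qed
  then have "s < 1" and big: "ereal (1 / (1 - s)) < r_odd x" by auto
  have "\<forall>\<^sub>F j in inf sequentially (principal (adm_indices x)). ereal (approx_exponent x j) \<le> ereal (1 / (1 - s))"
    using small eventually_conv_denom_ge_2[OF x] eventually_adm_indices[of x]
  proof eventually_elim
    case (elim j)
    define q q' where "q = real_of_int (conv_denom x j)" and "q' = real_of_int (conv_denom x (Suc j))"
    have j: "j \<ge> 1" using elim by (simp add: adm_indices_def)
    have q: "q \<ge> 2" using elim by (simp add: q_def)
    have q': "q' \<ge> q" using conv_denom_mono[OF x, of j] unfolding q_def q'_def of_int_le_iff .
    show ?case
    proof (rule ccontr)
      assume "\<not> ?thesis"
      then have "q powr (1 / (1 - s)) \<le> q powr approx_exponent x j"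
        using q by (intro powr_mono) auto
      also have "\<dots> \<le> 2 * (q * q')"
        unfolding q_def q'_def using elim by (intro conv_denom_product_bounds[OF x j])
      finally have "(q powr (1 / (1 - s))) powr ((1 - s) / 2) \<le> (2 * (q * q')) powr ((1 - s) / 2)"
        using s by (intro powr_mono2) auto
      also have "\<dots> = 2 powr ((1 - s) / 2) * sqrt (q * q') powr (1 - s)"
        using q q' by (simp add: powr_mult powr_powr flip: powr_half_sqrt)
      also have "\<dots> \<le> 2 powr 1 * sqrt (q * q') powr (1 - s)"
        using s by (intro mult_right_mono powr_mono) auto
      also have "(q powr (1 / (1 - s))) powr ((1 - s) / 2) = sqrt q"
        using \<open>s < 1\<close> q by (simp add: powr_powr flip: powr_half_sqrt)
      finally have "1 / 2 \<le> sqrt (q * q') powr (1 - s) / sqrt q"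
        using q by (simp add: field_simps)
      then have "1 / 2 \<le> conv_weight s x j"
        using \<open>s < 1\<close> unfolding conv_weight_eq[OF x] q_def q'_def by simp
      then show False using elim by simp
    qed
  qed
  then have "r_odd x \<le> ereal (1 / (1 - s))"
    unfolding r_odd_def by (rule Limsup_bounded)
  then show False using big by simp
qed

theorem theorem1p4:
  fixes s x :: real
  assumes "1/2 < s" and "s \<le> 1"
    and "0 < x" and "x < 1" and "x \<notin> \<rat>"
  shows "((ereal (s - 1) + 1 / r_odd x) / 2 > 0 \<longrightarrow> convergent (F_partial s x)) \<and>
         (Sigma_sum s x < \<infinity> \<longrightarrow> convergent (F_partial s x)) \<and>
         ((ereal (s - 1) + 1 / r_odd x) / 2 < 0 \<longrightarrow> \<not> convergent (F_partial s x)) \<and>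
         (Limsup (inf sequentially (principal (adm_indices x))) (\<lambda>j. ereal (conv_weight s x j)) > 0
            \<longrightarrow> \<not> convergent (F_partial s x))"
proof -
  have divergent: "\<not> convergent (F_partial s x)"
    if lim: "Limsup (inf sequentially (principal (adm_indices x))) (\<lambda>j. ereal (conv_weight s x j)) > 0"
  proof
    assume conv: "convergent (F_partial s x)"
    \<comment> \<open>The limit superior may be infinite, so a real number strictly below it is
      chosen as threshold.\<close>
    obtain \<eta> where \<eta>: "0 < ereal \<eta>" "ereal \<eta> < Limsup (inf sequentially (principal (adm_indices x))) (\<lambda>j. ereal (conv_weight s x j))"
      using ereal_dense2[OF lim] by blast
    have "\<forall>\<^sub>F j in inf sequentially (principal (adm_indices x)). ereal (conv_weight s x j) \<le> ereal \<eta>"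
      using conv_weight_small_if_convergent[OF assms(5,1,2) conv, of \<eta>] \<eta>(1)
      by (auto elim: eventually_mono)
    then show False using Limsup_bounded \<eta>(2) by (metis not_less)
  qed
  \<comment> \<open>Passage from a finite sum in the extended nonnegative reals to real summability,
    which rests on the weights being nonnegative.\<close>
  have "summable (\<lambda>j. if j \<in> adm_indices x then conv_weight s x j else 0)" if "Sigma_sum s x < \<infinity>"
  proof (rule summable_suminf_not_top)
    have "ennreal (if j \<in> adm_indices x then conv_weight s x j else 0)
        = (if j \<in> adm_indices x then ennreal (conv_weight s x j) else 0)" for j by simp
    then show "(\<Sum>j. ennreal (if j \<in> adm_indices x then conv_weight s x j else 0)) \<noteq> top"
      using that by (simp add: Sigma_sum_def infinity_ennreal_def)
  qed (simp add: conv_weight_nonneg[OF assms(5)])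
  then show ?thesis
    using divergent convergent_F_partial_if_summable[OF assms(5,1,2)]
      summable_conv_weight[OF assms(5,1,2)] Limsup_conv_weight_pos[OF assms(5,1,2)] by blast
qed

end
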